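(* Let $G$ be any locally compact topological group with unit element $e$, and let $\Omega\subset G$ be an open symmetric neighborhood of $e$ (i.e. $\Omega=\Omega^{-1}$). Let $z\in\Omega$ be a fixed element of finite order $o(z)=m<\infty$, and assume that for some natural number $N\le m$ $$\langle z\rangle\cap\Omega=\{z^n : -N\le n\le N\},\qquad \langle z\rangle:=\{z^n:n\in\mathbb{Z}\}.$$ Then $$\mathcal{C}^c_G(\Omega,z)=\mathcal{C}^{\#}_G(\Omega,z)=\mathcal{C}_m([-N,N])\quad\text{and}\quad \mathcal{K}^c_G(\Omega,z)=\mathcal{K}^{\#}_G(\Omega,z)=\mathcal{K}_m([-N,N]).$$
   Context: Locally compact groups are Hausdorff and not assumed commutative. A function $f:G\to\mathbb{C}$ on a group $G$ is positive definite, written $f\gg0$, if for all $n\in\mathbb{N}$, $x_1,\dots,x_n\in G$ and $c_1,\dots,c_n\in\mathbb{C}$ one has $\sum_{j=1}^n\sum_{k=1}^n c_j\overline{c_k}f(x_jx_k^{-1})\ge0$. $\operatorname{supp} f$ is the closed support of $f$, and $\operatorname{supp} f\Subset\Omega$ means that $\operatorname{supp} f$ is compact and contained in $\Omega$. Function classes: $\mathcal{F}^{\#}_G(\Omega):=\{f:G\to\mathbb{C} : f\gg0,\ f(e)=1,\ f(x)=0\ \forall x\notin\Omega\}$ (no continuity or measurability required); $\mathcal{F}^{c}_G(\Omega):=\{f:G\to\mathbb{C} : f\gg0,\ f(e)=1,\ f\in C(G),\ \operatorname{supp} f\Subset\Omega\}$; $\mathcal{F}^{\#\mathbb{R}}_G(\Omega)$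 and $\mathcal{F}^{c\mathbb{R}}_G(\Omega)$ are the subsets of real-valued functions in $\mathcal{F}^{\#}_G(\Omega)$ and $\mathcal{F}^{c}_G(\Omega)$, respectively. Extremal constants: $\mathcal{C}^{\#}_G(\Omega,z):=\sup\{|f(z)|:f\in\mathcal{F}^{\#}_G(\Omega)\}$, $\mathcal{C}^{c}_G(\Omega,z):=\sup\{|f(z)|:f\in\mathcal{F}^{c}_G(\Omega)\}$, $\mathcal{K}^{\#}_G(\Omega,z):=\sup\{|f(z)|:f\in\mathcal{F}^{\#\mathbb{R}}_G(\Omega)\}$, $\mathcal{K}^{c}_G(\Omega,z):=\sup\{|f(z)|:f\in\mathcal{F}^{c\mathbb{R}}_G(\Omega)\}$. For $\mathbb{Z}_m:=\mathbb{Z}/m\mathbb{Z}$ (written additively) and symmetric $H\subset\mathbb{Z}_m$ containing $0$: $\mathcal{C}_m(H):=\sup\{|\varphi(1)| : \varphi:\mathbb{Z}_m\to\mathbb{C},\ \varphi\gg0,\ \varphi(0)=1,\ \operatorname{supp}\varphi\subset H\}$, and $\mathcal{K}_m(H)$ is the same supremum restricted to real-valued $\varphi$. Here $[-N,N]$ stands for the set of residue classes mod $m$ of the integers $-N,\dots,N$. *)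

theory Defs
  imports "HOL-Analysis.Analysis" "HOL-Algebra.Elementary_Groups"
    "HOL-Algebra.Multiplicative_Group"
begin

(* Groups are written multiplicatively and need not be commutative; the topology lives on
   the carrier.  Functions on the group are total on the type 'a, so only their values on
   the carrier carry information, and every condition below refers to the carrier only. *)

locale topological_group = group G for G (structure) +
  fixes T :: "'a topology"
  assumes topspace_eq_carrier: "topspace T = carrier G"
    and continuous_mult: "continuous_map (prod_topology T T) T (\<lambda>(x, y). x \<otimes> y)"
    and continuous_inv: "continuous_map T T (\<lambda>x. inv x)"

locale locally_compact_group = topological_group +
  assumes Hausdorff: "Hausdorff_space T"
    and locally_compact: "locally_compact_space T"

(* Membership in the nonnegative reals includes the claim that the complex double sum is real. *)

definition positive_definite :: "('a, 'b) monoid_scheme \<Rightarrow> ('a \<Rightarrow> complex) \<Rightarrow> bool" where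
  "positive_definite G f \<longleftrightarrow>
     (\<forall>(n::nat) (x :: nat \<Rightarrow> 'a) (c :: nat \<Rightarrow> complex).
        (\<forall>j\<in>{1..n}. x j \<in> carrier G) \<longrightarrow>
        (\<Sum>j=1..n. \<Sum>k=1..n. c j * cnj (c k) * f (x j \<otimes>\<^bsub>G\<^esub> inv\<^bsub>G\<^esub> (x k))) \<in> \<real>\<^sub>\<ge>\<^sub>0)"

definition closed_support :: "'a topology \<Rightarrow> ('a \<Rightarrow> complex) \<Rightarrow> 'a set" where
  "closed_support T f = T closure_of {x \<in> topspace T. f x \<noteq> 0}"

definition F_sharp :: "('a, 'b) monoid_scheme \<Rightarrow> 'a set \<Rightarrow> ('a \<Rightarrow> complex) set" where
  "F_sharp G \<Omega> =
     {f. positive_definite G f \<and> f \<one>\<^bsub>G\<^esub> = 1 \<and> (\<forall>x\<in>carrier G - \<Omega>. f x = 0)}"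

definition F_cont ::
  "('a, 'b) monoid_scheme \<Rightarrow> 'a topology \<Rightarrow> 'a set \<Rightarrow> ('a \<Rightarrow> complex) set" where
  "F_cont G T \<Omega> =
     {f. positive_definite G f \<and> f \<one>\<^bsub>G\<^esub> = 1 \<and> continuous_map T euclidean f \<and>
         compactin T (closed_support T f) \<and> closed_support T f \<subseteq> \<Omega>}"

definition real_valued_on :: "'a set \<Rightarrow> ('a \<Rightarrow> complex) \<Rightarrow> bool" where
  "real_valued_on A f \<longleftrightarrow> (\<forall>x\<in>A. f x \<in> \<real>)"

definition F_sharp_real :: "('a, 'b) monoid_scheme \<Rightarrow> 'a set \<Rightarrow> ('a \<Rightarrow> complex) set" where
  "F_sharp_real G \<Omega> = {f \<in> F_sharp G \<Omega>. real_valued_on (carrier G) f}"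

definition F_cont_real ::
  "('a, 'b) monoid_scheme \<Rightarrow> 'a topology \<Rightarrow> 'a set \<Rightarrow> ('a \<Rightarrow> complex) set" where
  "F_cont_real G T \<Omega> = {f \<in> F_cont G T \<Omega>. real_valued_on (carrier G) f}"

(* A positive definite f with f e = 1 satisfies |f| \<le> 1, and for an open neighborhood of e
   in a locally compact group none of the four classes is empty; so the suprema below are
   genuine suprema of nonempty bounded sets of reals. *)

definition C_sharp :: "('a, 'b) monoid_scheme \<Rightarrow> 'a set \<Rightarrow> 'a \<Rightarrow> real" where
  "C_sharp G \<Omega> z = (SUP f\<in>F_sharp G \<Omega>. cmod (f z))"

definition C_cont :: "('a, 'b) monoid_scheme \<Rightarrow> 'a topology \<Rightarrow> 'a set \<Rightarrow> 'a \<Rightarrow> real" where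
  "C_cont G T \<Omega> z = (SUP f\<in>F_cont G T \<Omega>. cmod (f z))"

definition K_sharp :: "('a, 'b) monoid_scheme \<Rightarrow> 'a set \<Rightarrow> 'a \<Rightarrow> real" where
  "K_sharp G \<Omega> z = (SUP f\<in>F_sharp_real G \<Omega>. cmod (f z))"

definition K_cont :: "('a, 'b) monoid_scheme \<Rightarrow> 'a topology \<Rightarrow> 'a set \<Rightarrow> 'a \<Rightarrow> real" where
  "K_cont G T \<Omega> z = (SUP f\<in>F_cont_real G T \<Omega>. cmod (f z))"

(* For m > 0, integer_mod_group m has carrier {0..<m} with addition mod m.  The class of the
   integer 1 is "1 mod int m", which is 0 when m = 1.  The group is discrete, so
   "supp phi is contained in H" just says that phi vanishes off H. *)

definition C_cyclic :: "nat \<Rightarrow> int set \<Rightarrow> real" where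
  "C_cyclic m H =
     Sup {cmod (\<phi> (1 mod int m)) | \<phi>.
            positive_definite (integer_mod_group m) \<phi> \<and> \<phi> 0 = 1 \<and>
            (\<forall>k\<in>carrier (integer_mod_group m) - H. \<phi> k = 0)}"

definition K_cyclic :: "nat \<Rightarrow> int set \<Rightarrow> real" where
  "K_cyclic m H =
     Sup {cmod (\<phi> (1 mod int m)) | \<phi>.
            positive_definite (integer_mod_group m) \<phi> \<and> \<phi> 0 = 1 \<and>
            (\<forall>k\<in>carrier (integer_mod_group m) - H. \<phi> k = 0) \<and>
            real_valued_on (carrier (integer_mod_group m)) \<phi>}"

definition residue_interval :: "nat \<Rightarrow> nat \<Rightarrow> int set" where
  "residue_interval m N = (\<lambda>k. k mod int m) ` {- int N..int N}"

end

theory Submission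
  imports Defs
begin

text \<open>All four suprema are taken over the same sets of values as their cyclic counterparts.
  Restricting \<open>f\<close> to the powers of \<open>z\<close> gives a positive definite function on the integers mod \<open>m\<close>
  supported in \<open>[-N, N]\<close>.  Conversely, let \<open>\<phi>\<close> be such a function, and let
  \<open>w x = J (\<lambda>y. g (y x\<inverse>) g y)\<close> be a normalised autocorrelation of a bump function \<open>g\<close>
  supported near the unit, where \<open>J\<close> is a right Haar functional.  Then
  \<open>f x = 1/m \<Sum>a \<Sum>b \<phi> (a - b) w (z\<^sup>-\<^sup>a x z\<^sup>b)\<close>, with \<open>a\<close> and \<open>b\<close> running through the
  residues mod \<open>m\<close>, is continuous, is supported close to the \<open>z\<^sup>k\<close> with \<open>\<phi> k \<noteq> 0\<close>, satisfies
  \<open>f (z\<^sup>k) = \<phi> k\<close>, and is positive definite by a Schur product argument: the kernel of \<open>w\<close> is a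
  Gram kernel, so \<open>f\<close> inherits positivity from \<open>\<phi>\<close> pointwise under \<open>J\<close>.  Summing over both
  \<open>a\<close> and \<open>b\<close> replaces invariance of \<open>w\<close> under conjugation by \<open>z\<close>.\<close>

subsection \<open>Uniform continuity and compactly supported functions\<close>

context topological_group
begin

lemma carrier_topspace [simp]: "topspace T = carrier G"
  by (rule topspace_eq_carrier)

lemma continuous_map_group_mult:
  assumes "continuous_map X T f" "continuous_map X T g"
  shows "continuous_map X T (\<lambda>x. f x \<otimes> g x)"
proof -
  have "continuous_map X T ((\<lambda>(x, y). x \<otimes> y) \<circ> (\<lambda>x. (f x, g x)))"
    using assms continuous_mult by (intro continuous_map_compose) (auto simp: continuous_map_pairwise o_def)
  then show ?thesis by (simp add: o_def)
qed

lemma continuous_map_inverse: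
  assumes "continuous_map X T f"
  shows "continuous_map X T (\<lambda>x. inv (f x))"
  using continuous_map_compose[OF assms continuous_inv] by (simp add: o_def)

lemma continuous_map_translate:
  assumes "a \<in> carrier G" "b \<in> carrier G"
  shows "continuous_map T T (\<lambda>x. a \<otimes> x \<otimes> b)"
  using assms by (intro continuous_map_group_mult) (auto simp: continuous_map_const)

lemma openin_translate:
  assumes "openin T U" "a \<in> carrier G" "b \<in> carrier G"
  shows "openin T {x \<in> carrier G. a \<otimes> x \<otimes> b \<in> U}"
  using openin_continuous_map_preimage[OF continuous_map_translate[OF assms(2,3)] assms(1)] by simp

text \<open>Compactness of \<open>K\<close>: the open set \<open>W\<close> of pairs with small
  oscillation contains the slice over the unit and \<open>K\<close>, so by the tube lemma it
  contains a product neighbourhood \<open>A \<times> B\<close> of that slice. Points outside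
  \<open>K\<close> are handled by the support condition and by inverting \<open>v\<close>.\<close>

lemma uniformly_continuous_left:
  fixes f :: "'a \<Rightarrow> real"
  assumes f: "continuous_map T euclideanreal f" and K: "compactin T K"
    and f0: "{x \<in> carrier G. f x \<noteq> 0} \<subseteq> K" and "\<epsilon> > 0"
  obtains V where "openin T V" "\<one> \<in> V"
    "\<And>v x. v \<in> V \<Longrightarrow> x \<in> carrier G \<Longrightarrow> \<bar>f (v \<otimes> x) - f x\<bar> < \<epsilon>"
proof -
  define W where "W = {p \<in> topspace (prod_topology T T). \<bar>f (fst p \<otimes> snd p) - f (snd p)\<bar> \<in> {..<\<epsilon>}}"
  have fm: "continuous_map (prod_topology T T) euclideanreal (\<lambda>p. f (fst p \<otimes> snd p))"
    using continuous_map_compose[OF continuous_map_group_mult[OF continuous_map_fst continuous_map_snd] f]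
    by (simp add: o_def)
  have fs: "continuous_map (prod_topology T T) euclideanreal (\<lambda>p. f (snd p))"
    using continuous_map_compose[OF continuous_map_snd f] by (simp add: o_def)
  have "openin (prod_topology T T) W"
    unfolding W_def
    by (rule openin_continuous_map_preimage[where Y = euclideanreal])
       (auto intro!: continuous_map_real_abs continuous_map_diff fm fs)
  moreover have "compactin T {\<one>}" by simp
  moreover have "{\<one>} \<times> K \<subseteq> W"
    using compactin_subset_topspace[OF K] \<open>\<epsilon> > 0\<close> by (auto simp: W_def)
  ultimately obtain A B where AB: "openin T A" "openin T B" "\<one> \<in> A" "K \<subseteq> B" "A \<times> B \<subseteq> W"
    using Wallace_theorem_prod_topology[of T "{\<one>}" T K W] K by auto
  \<comment> \<open>Both \<open>v\<close> and \<open>inv v\<close> must lie in \<open>A\<close>: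
    when only \<open>v \<otimes> x\<close> is in \<open>K\<close>, the estimate is applied at
    \<open>v \<otimes> x\<close> with the increment \<open>inv v\<close>.\<close>
  define V where "V = A \<inter> {x \<in> carrier G. inv x \<in> A}"
  have "openin T V"
    using openin_continuous_map_preimage[OF continuous_inv AB(1)] AB(1)
    unfolding V_def by auto
  moreover have "\<one> \<in> V" using AB(3) by (simp add: V_def)
  moreover have "\<bar>f (v \<otimes> x) - f x\<bar> < \<epsilon>" if v: "v \<in> V" and x: "x \<in> carrier G" for v x
  proof -
    have vc: "v \<in> carrier G" using v by (simp add: V_def)
    consider "x \<in> K" | "v \<otimes> x \<in> K" | "x \<notin> K" "v \<otimes> x \<notin> K" by blast
    then show ?thesis
    proof cases
      case 1
      then have "(v, x) \<in> W" using v AB by (auto simp: V_def)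
      then show ?thesis by (simp add: W_def)
    next
      case 2
      then have "(inv v, v \<otimes> x) \<in> W" using v AB by (auto simp: V_def)
      then show ?thesis using vc x by (simp add: W_def m_assoc[symmetric] abs_minus_commute)
    next
      case 3
      then have "f x = 0" "f (v \<otimes> x) = 0" using f0 vc x by auto
      then show ?thesis using \<open>\<epsilon> > 0\<close> by simp
    qed
  qed
  ultimately show thesis by (rule that)
qed

text \<open>Inversion exchanges the two sides, so the left version is applied to \<open>f\<close>
  composed with inversion.\<close>

lemma uniformly_continuous_right:
  fixes f :: "'a \<Rightarrow> real"
  assumes f: "continuous_map T euclideanreal f" and K: "compactin T K"
    and f0: "{x \<in> carrier G. f x \<noteq> 0} \<subseteq> K" and "\<epsilon> > 0"
  obtains V where "openin T V" "\<one> \<in> V"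
    "\<And>v x. v \<in> V \<Longrightarrow> x \<in> carrier G \<Longrightarrow> \<bar>f (x \<otimes> v) - f x\<bar> < \<epsilon>"
proof -
  have "continuous_map T euclideanreal (\<lambda>x. f (inv x))"
    using continuous_map_compose[OF continuous_inv f] by (simp add: o_def)
  moreover have "compactin T ((\<lambda>x. inv x) ` K)"
    using image_compactin[OF K continuous_inv] .
  moreover have "{x \<in> carrier G. f (inv x) \<noteq> 0} \<subseteq> (\<lambda>x. inv x) ` K"
  proof
    fix x assume "x \<in> {x \<in> carrier G. f (inv x) \<noteq> 0}"
    then have "inv x \<in> K" "x = inv (inv x)" using f0 by auto
    then show "x \<in> (\<lambda>x. inv x) ` K" by blast
  qed
  ultimately obtain V where V: "openin T V" "\<one> \<in> V"
    "\<And>v x. v \<in> V \<Longrightarrow> x \<in> carrier G \<Longrightarrow> \<bar>f (inv (v \<otimes> x)) - f (inv x)\<bar> < \<epsilon>"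
    using uniformly_continuous_left[where f = "\<lambda>x. f (inv x)" and K = "(\<lambda>x. inv x) ` K"]
      \<open>\<epsilon> > 0\<close> by blast
  show thesis
  proof
    show "openin T {x \<in> carrier G. inv x \<in> V}"
      using openin_continuous_map_preimage[OF continuous_inv V(1)] by simp
    show "\<one> \<in> {x \<in> carrier G. inv x \<in> V}" using V(2) by simp
    show "\<bar>f (x \<otimes> v) - f x\<bar> < \<epsilon>" if "v \<in> {x \<in> carrier G. inv x \<in> V}" "x \<in> carrier G" for v x
      using V(3)[of "inv v" "inv x"] that by (simp add: inv_mult_group)
  qed
qed

text \<open>The cone of nonnegative continuous functions of compact support, the domain of the Haar
  functional. Covering numbers are meaningful only for nonnegative functions, so signed integrands
  are split into differences later.\<close>

definition Cc_nonneg :: "('a \<Rightarrow> real) set" where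
  "Cc_nonneg = {f. continuous_map T euclideanreal f \<and> (\<forall>x\<in>carrier G. 0 \<le> f x) \<and>
     (\<exists>K. compactin T K \<and> {x \<in> carrier G. f x \<noteq> 0} \<subseteq> K)}"

lemma Cc_nonnegI:
  assumes "continuous_map T euclideanreal f" "\<And>x. x \<in> carrier G \<Longrightarrow> 0 \<le> f x"
    "compactin T K" "{x \<in> carrier G. f x \<noteq> 0} \<subseteq> K"
  shows "f \<in> Cc_nonneg"
  using assms unfolding Cc_nonneg_def by blast

lemma Cc_nonneg_support:
  assumes "f \<in> Cc_nonneg"
  obtains K where "compactin T K" "{x \<in> carrier G. f x \<noteq> 0} \<subseteq> K"
  using assms unfolding Cc_nonneg_def by blast

lemma Cc_nonneg_continuous: "f \<in> Cc_nonneg \<Longrightarrow> continuous_map T euclideanreal f"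
  unfolding Cc_nonneg_def by (elim CollectE conjE)

lemma Cc_nonneg_ge_0: "f \<in> Cc_nonneg \<Longrightarrow> x \<in> carrier G \<Longrightarrow> 0 \<le> f x"
  unfolding Cc_nonneg_def by (elim CollectE conjE bspec)

lemma Cc_nonneg_add:
  assumes "f \<in> Cc_nonneg" "g \<in> Cc_nonneg"
  shows "(\<lambda>x. f x + g x) \<in> Cc_nonneg"
proof -
  obtain K where K: "compactin T K" "{x \<in> carrier G. f x \<noteq> 0} \<subseteq> K"
    using Cc_nonneg_support[OF assms(1)] by blast
  obtain L where L: "compactin T L" "{x \<in> carrier G. g x \<noteq> 0} \<subseteq> L"
    using Cc_nonneg_support[OF assms(2)] by blast
  show ?thesis
  proof (rule Cc_nonnegI)
    show "continuous_map T euclideanreal (\<lambda>x. f x + g x)"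
      using assms by (intro continuous_map_add Cc_nonneg_continuous)
    show "compactin T (K \<union> L)" using K(1) L(1) by (rule compactin_Un)
    show "{x \<in> carrier G. f x + g x \<noteq> 0} \<subseteq> K \<union> L"
    proof
      fix x assume x: "x \<in> {x \<in> carrier G. f x + g x \<noteq> 0}"
      then have "f x \<noteq> 0 \<or> g x \<noteq> 0" by auto
      then show "x \<in> K \<union> L" using x K(2) L(2) by blast
    qed
  qed (use assms in \<open>auto intro: add_nonneg_nonneg Cc_nonneg_ge_0\<close>)
qed

lemma Cc_nonneg_mult:
  assumes f: "f \<in> Cc_nonneg" and g: "continuous_map T euclideanreal g" "\<And>x. x \<in> carrier G \<Longrightarrow> 0 \<le> g x"
  shows "(\<lambda>x. g x * f x) \<in> Cc_nonneg"
proof -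
  obtain K where K: "compactin T K" "{x \<in> carrier G. f x \<noteq> 0} \<subseteq> K"
    using Cc_nonneg_support[OF f] by blast
  show ?thesis
  proof (rule Cc_nonnegI)
    show "continuous_map T euclideanreal (\<lambda>x. g x * f x)"
      by (rule continuous_map_real_mult[OF g(1) Cc_nonneg_continuous[OF f]])
    show "{x \<in> carrier G. g x * f x \<noteq> 0} \<subseteq> K"
      using K(2) by auto
  qed (use K(1) f g(2) in \<open>auto intro: mult_nonneg_nonneg Cc_nonneg_ge_0\<close>)
qed

lemma Cc_nonneg_cmult: "f \<in> Cc_nonneg \<Longrightarrow> 0 \<le> c \<Longrightarrow> (\<lambda>x. c * f x) \<in> Cc_nonneg"
  by (rule Cc_nonneg_mult) auto

lemma Cc_nonneg_zero: "(\<lambda>x. 0) \<in> Cc_nonneg"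
  by (rule Cc_nonnegI[of _ "{}"]) auto

lemma Cc_nonneg_sum: "(\<And>i. i \<in> A \<Longrightarrow> f i \<in> Cc_nonneg) \<Longrightarrow> (\<lambda>x. \<Sum>i\<in>A. f i x) \<in> Cc_nonneg"
  by (induction A rule: infinite_finite_induct) (auto intro: Cc_nonneg_add simp: Cc_nonneg_zero)

lemma Cc_nonneg_translate:
  assumes "f \<in> Cc_nonneg" "s \<in> carrier G"
  shows "(\<lambda>x. f (x \<otimes> s)) \<in> Cc_nonneg"
proof -
  obtain K where K: "compactin T K" "{x \<in> carrier G. f x \<noteq> 0} \<subseteq> K"
    using Cc_nonneg_support[OF assms(1)] by blast
  have tr: "continuous_map T T (\<lambda>x. x \<otimes> t)" if "t \<in> carrier G" for t
    using that by (intro continuous_map_group_mult) auto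
  show ?thesis
  proof (rule Cc_nonnegI)
    show "continuous_map T euclideanreal (\<lambda>x. f (x \<otimes> s))"
      using continuous_map_compose[OF tr[OF assms(2)] Cc_nonneg_continuous[OF assms(1)]]
      by (simp add: o_def)
    show "compactin T ((\<lambda>x. x \<otimes> inv s) ` K)"
      using image_compactin[OF K(1) tr] assms by simp
    show "{x \<in> carrier G. f (x \<otimes> s) \<noteq> 0} \<subseteq> (\<lambda>x. x \<otimes> inv s) ` K"
    proof
      fix x assume "x \<in> {x \<in> carrier G. f (x \<otimes> s) \<noteq> 0}"
      then have "x \<otimes> s \<in> K" "x = (x \<otimes> s) \<otimes> inv s"
        using assms(2) K(2) by (auto simp: m_assoc)
      then show "x \<in> (\<lambda>x. x \<otimes> inv s) ` K" by blast
    qed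
  qed (use assms Cc_nonneg_ge_0 in auto)
qed

text \<open>Fix \<open>w\<close> in \<open>W\<close>. Every \<open>x\<close> satisfies
  \<open>x \<otimes> s \<in> W\<close> for \<open>s = inv x \<otimes> w\<close>, so the translates
  of \<open>W\<close> cover \<open>K\<close> and compactness leaves finitely many. The centres are
  returned as a list because coverings are lists.\<close>

lemma finite_translates_cover:
  assumes K: "compactin T K" and W: "openin T W" "W \<noteq> {}"
  obtains S where "set S \<subseteq> carrier G" "\<And>x. x \<in> K \<Longrightarrow> \<exists>s\<in>set S. x \<otimes> s \<in> W"
proof -
  obtain w where w: "w \<in> W" using W by blast
  have wc: "w \<in> carrier G" using openin_subset[OF W(1)] w by auto
  have Kc: "K \<subseteq> carrier G" using compactin_subset_topspace[OF K] by simp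
  let ?t = "\<lambda>s. {x \<in> carrier G. \<one> \<otimes> x \<otimes> s \<in> W}"
  have "openin T U" if "U \<in> ?t ` carrier G" for U
    using that openin_translate[OF W(1)] by auto
  moreover have "K \<subseteq> \<Union>(?t ` carrier G)"
  proof
    fix x assume "x \<in> K"
    then have "x \<in> ?t (inv x \<otimes> w)" "inv x \<otimes> w \<in> carrier G"
      using Kc wc w by (auto simp: m_assoc[symmetric])
    then show "x \<in> \<Union>(?t ` carrier G)" by blast
  qed
  ultimately obtain \<F> where F: "finite \<F>" "\<F> \<subseteq> ?t ` carrier G" "K \<subseteq> \<Union>\<F>"
    using K unfolding compactin_def by meson
  obtain S where S: "finite S" "S \<subseteq> carrier G" "\<F> = ?t ` S"
    using finite_subset_image[OF F(1,2)] by blast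
  obtain L where L: "set L = S" using finite_list[OF S(1)] by blast
  show thesis
  proof
    show "set L \<subseteq> carrier G" using L S(2) by simp
    show "\<exists>s\<in>set L. x \<otimes> s \<in> W" if x: "x \<in> K" for x
    proof -
      obtain s where s: "s \<in> S" "x \<in> ?t s" using F(3) S(3) x by blast
      then have "x \<otimes> s \<in> W" using S(2) by auto
      then show ?thesis using s(1) L by blast
    qed
  qed
qed

lemma Cc_nonneg_bounded:
  assumes "f \<in> Cc_nonneg"
  obtains B where "0 \<le> B" "\<And>x. x \<in> carrier G \<Longrightarrow> f x \<le> B"
proof -
  obtain K where K: "compactin T K" "{x \<in> carrier G. f x \<noteq> 0} \<subseteq> K"
    using Cc_nonneg_support[OF assms] by blast
  have "compactin euclideanreal (f ` K)"
    using image_compactin[OF K(1) Cc_nonneg_continuous[OF assms]] .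
  then have "bdd_above (f ` K)"
    by (simp add: compact_imp_bounded bounded_imp_bdd_above)
  then obtain B where B: "\<And>x. x \<in> K \<Longrightarrow> f x \<le> B" by (auto simp: bdd_above_def)
  show thesis
  proof
    \<comment> \<open>\<open>B\<close> bounds \<open>f\<close> on \<open>K\<close> only and is
      arbitrary when \<open>K\<close> is empty; off \<open>K\<close> the function is 0.\<close>
    show "f x \<le> max B 0" if "x \<in> carrier G" for x
      using K(2) B[of x] that by (cases "f x = 0") auto
  qed simp
qed

end

subsection \<open>Covering numbers\<close>

context topological_group
begin

text \<open>A pair \<open>(c, s)\<close> puts weight \<open>c\<close> on the translate of
  \<open>U\<close> with centre \<open>inv s\<close>. With lists, repeated translates are allowed and
  appending coverings adds both their functions and their weights.\<close>

definition covering :: "'a set \<Rightarrow> ('a \<Rightarrow> real) \<Rightarrow> (real \<times> 'a) list \<Rightarrow> bool" where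
  "covering U f L \<longleftrightarrow> set L \<subseteq> {0..} \<times> carrier G \<and>
     (\<forall>x\<in>carrier G. f x \<le> (\<Sum>(c, s)\<leftarrow>L. c * indicator U (x \<otimes> s)))"

text \<open>This is Haar's covering index (f : U), taken with respect to the indicator of
  \<open>U\<close>; on \<open>Cc_nonneg\<close> and for nonempty open \<open>U\<close> the infimum
  runs over a nonempty set of nonnegative numbers.\<close>

definition covering_number :: "'a set \<Rightarrow> ('a \<Rightarrow> real) \<Rightarrow> real" where
  "covering_number U f = Inf {sum_list (map fst L) |L. covering U f L}"

lemma coveringI:
  assumes "set L \<subseteq> {0..} \<times> carrier G"
    "\<And>x. x \<in> carrier G \<Longrightarrow> f x \<le> (\<Sum>(c, s)\<leftarrow>L. c * indicator U (x \<otimes> s))"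
  shows "covering U f L"
  using assms by (simp add: covering_def)

lemma covering_weight_nonneg: "covering U f L \<Longrightarrow> 0 \<le> sum_list (map fst L)"
  by (rule sum_list_nonneg) (auto simp: covering_def)

lemma covering_number_le: "covering U f L \<Longrightarrow> covering_number U f \<le> sum_list (map fst L)"
  unfolding covering_number_def
  by (rule cInf_lower) (auto intro!: bdd_belowI[of _ 0] covering_weight_nonneg)

lemma covering_number_ge:
  assumes "covering U f L" "\<And>L. covering U f L \<Longrightarrow> b \<le> sum_list (map fst L)"
  shows "b \<le> covering_number U f"
  unfolding covering_number_def using assms by (intro cInf_greatest) blast+

lemma covering_number_approx:
  assumes "covering U f L0" "covering_number U f < b"
  obtains L where "covering U f L" "sum_list (map fst L) < b"
proof -
  have "\<not> (\<forall>L. covering U f L \<longrightarrow> b \<le> sum_list (map fst L))"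
    using covering_number_ge[OF assms(1), of b] assms(2) by force
  then show thesis using that by (auto simp: not_le)
qed

text \<open>Finitely many translates of \<open>U\<close> cover the support, and each of them gets an
  upper bound of \<open>f\<close> as weight.\<close>

lemma covering_exists:
  assumes f: "f \<in> Cc_nonneg" and U: "openin T U" "U \<noteq> {}"
  obtains L where "covering U f L"
proof -
  obtain K where K: "compactin T K" "{x \<in> carrier G. f x \<noteq> 0} \<subseteq> K"
    using Cc_nonneg_support[OF f] by blast
  obtain S where S: "set S \<subseteq> carrier G" "\<And>x. x \<in> K \<Longrightarrow> \<exists>s\<in>set S. x \<otimes> s \<in> U"
    using finite_translates_cover[OF K(1) U] by metis
  obtain B where B: "0 \<le> B" "\<And>x. x \<in> carrier G \<Longrightarrow> f x \<le> B"
    using Cc_nonneg_bounded[OF f] by metis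
  have "covering U f (map (\<lambda>s. (B, s)) S)"
  proof (rule coveringI)
    show "set (map (Pair B) S) \<subseteq> {0..} \<times> carrier G" using B(1) S(1) by auto
    fix x assume x: "x \<in> carrier G"
    have nn: "0 \<le> (\<Sum>s\<leftarrow>R. B * indicator U (x \<otimes> s))" for R
      using B(1) by (intro sum_list_nonneg) auto
    have "f x \<le> (\<Sum>s\<leftarrow>S. B * indicator U (x \<otimes> s))"
    proof (cases "x \<in> K")
      case True
      then obtain s where s: "s \<in> set S" "x \<otimes> s \<in> U" using S(2) by blast
      \<comment> \<open>Splitting the list at \<open>s\<close> isolates one summand equal to
        \<open>B\<close>; the others are nonnegative.\<close>
      then obtain S1 S2 where "S = S1 @ s # S2" by (meson split_list)
      then show ?thesis using nn[of S1] nn[of S2] B(2)[OF x] s(2) by simp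
    next
      case False
      then have "f x = 0" using K(2) x by blast
      then show ?thesis using nn by simp
    qed
    then show "f x \<le> (\<Sum>(c, s)\<leftarrow>map (Pair B) S. c * indicator U (x \<otimes> s))"
      by (simp add: o_def)
  qed
  then show thesis by (rule that)
qed

section \<open>Covering numbers as a right invariant sublinear functional\<close>

context
  fixes U assumes U: "openin T U" "U \<noteq> {}"
begin

lemma covering_number_mono:
  assumes "g \<in> Cc_nonneg" "\<And>x. x \<in> carrier G \<Longrightarrow> f x \<le> g x"
  shows "covering_number U f \<le> covering_number U g"
proof -
  obtain L0 where L0: "covering U g L0" using covering_exists[OF assms(1) U] by blast
  show ?thesis
  proof (rule covering_number_ge[OF L0])
    fix L assume "covering U g L"
    then have "covering U f L" using assms(2) unfolding covering_def by (meson order_trans)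
    then show "covering_number U f \<le> sum_list (map fst L)" by (rule covering_number_le)
  qed
qed

text \<open>Nearly optimal coverings of \<open>f\<close> and \<open>g\<close>, appended to each
  other, cover the sum.\<close>

lemma covering_number_add:
  assumes "f \<in> Cc_nonneg" "g \<in> Cc_nonneg"
  shows "covering_number U (\<lambda>x. f x + g x) \<le> covering_number U f + covering_number U g"
proof (rule field_le_epsilon)
  fix e :: real assume e: "e > 0"
  obtain L0 where L0: "covering U f L0" using covering_exists[OF assms(1) U] by blast
  obtain L where L: "covering U f L" "sum_list (map fst L) < covering_number U f + e/2"
    using covering_number_approx[OF L0, of "covering_number U f + e/2"] e by auto
  obtain M0 where M0: "covering U g M0" using covering_exists[OF assms(2) U] by blast
  obtain M where M: "covering U g M" "sum_list (map fst M) < covering_number U g + e/2"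
    using covering_number_approx[OF M0, of "covering_number U g + e/2"] e by auto
  have "covering U (\<lambda>x. f x + g x) (L @ M)"
    using L(1) M(1) unfolding covering_def by (auto intro: add_mono)
  from covering_number_le[OF this] L(2) M(2)
  show "covering_number U (\<lambda>x. f x + g x) \<le> covering_number U f + covering_number U g + e"
    by simp
qed

lemma covering_number_cmult_le:
  assumes "f \<in> Cc_nonneg" "0 < c"
  shows "covering_number U (\<lambda>x. c * f x) \<le> c * covering_number U f"
proof -
  obtain L0 where L0: "covering U f L0" using covering_exists[OF assms(1) U] by blast
  have "covering_number U (\<lambda>x. c * f x) / c \<le> covering_number U f"
  proof (rule covering_number_ge[OF L0])
    fix L assume L: "covering U f L"
    have sl: "(\<Sum>(d, s)\<leftarrow>map (\<lambda>(d, s). (c * d, s)) R. d * indicator U (x \<otimes> s))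
        = c * (\<Sum>(d, s)\<leftarrow>R. d * indicator U (x \<otimes> s))"
      and sw: "sum_list (map fst (map (\<lambda>(d, s). (c * d, s)) R)) = c * sum_list (map fst R)" for R x
      by (induction R) (auto simp: algebra_simps)
    have "covering U (\<lambda>x. c * f x) (map (\<lambda>(d, s). (c * d, s)) L)"
    proof (rule coveringI)
      show "set (map (\<lambda>(d, s). (c * d, s)) L) \<subseteq> {0..} \<times> carrier G"
        using L assms(2) unfolding covering_def by auto
      show "c * f x \<le> (\<Sum>(d, s)\<leftarrow>map (\<lambda>(d, s). (c * d, s)) L. d * indicator U (x \<otimes> s))"
        if "x \<in> carrier G" for x
        unfolding sl using L assms(2) that unfolding covering_def by (intro mult_left_mono) auto
    qed
    from covering_number_le[OF this, unfolded sw]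
    show "covering_number U (\<lambda>x. c * f x) / c \<le> sum_list (map fst L)"
      using assms(2) by (simp add: pos_divide_le_eq mult.commute)
  qed
  then show ?thesis using assms(2) by (simp add: pos_divide_le_eq mult.commute)
qed

lemma covering_number_cmult:
  assumes "f \<in> Cc_nonneg" "0 < c"
  shows "covering_number U (\<lambda>x. c * f x) = c * covering_number U f"
proof (rule antisym[OF covering_number_cmult_le[OF assms]])
  have "covering_number U (\<lambda>x. (1 / c) * (c * f x)) \<le> (1 / c) * covering_number U (\<lambda>x. c * f x)"
    using assms by (intro covering_number_cmult_le Cc_nonneg_cmult) auto
  then show "c * covering_number U f \<le> covering_number U (\<lambda>x. c * f x)"
    using assms(2) by (simp add: pos_le_divide_eq mult.commute)
qed

text \<open>Since \<open>x \<otimes> (t \<otimes> s) = (x \<otimes> t) \<otimes> s\<close>,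
  multiplying every \<open>s\<close> by \<open>t\<close> on the left turns a covering of
  \<open>f\<close> into one of the translate without changing the weights.\<close>

lemma covering_number_translate_le:
  assumes "f \<in> Cc_nonneg" "t \<in> carrier G"
  shows "covering_number U (\<lambda>x. f (x \<otimes> t)) \<le> covering_number U f"
proof -
  obtain L0 where L0: "covering U f L0" using covering_exists[OF assms(1) U] by blast
  show ?thesis
  proof (rule covering_number_ge[OF L0])
    fix L assume L: "covering U f L"
    have sl: "(\<Sum>(d, s)\<leftarrow>map (\<lambda>(d, s). (d, t \<otimes> s)) R. d * indicator U (x \<otimes> s))
        = (\<Sum>(d, s)\<leftarrow>R. d * indicator U (x \<otimes> t \<otimes> s))"
      if "x \<in> carrier G" "set R \<subseteq> {0..} \<times> carrier G" for R x
      using that by (induction R) (auto simp: m_assoc assms(2))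
    have sw: "map fst (map (\<lambda>(d, s). (d, t \<otimes> s)) L) = map fst L" by auto
    have "covering U (\<lambda>x. f (x \<otimes> t)) (map (\<lambda>(d, s). (d, t \<otimes> s)) L)"
    proof (rule coveringI)
      show "set (map (\<lambda>(d, s). (d, t \<otimes> s)) L) \<subseteq> {0..} \<times> carrier G"
        using L assms(2) unfolding covering_def by auto
      show "f (x \<otimes> t) \<le> (\<Sum>(d, s)\<leftarrow>map (\<lambda>(d, s). (d, t \<otimes> s)) L. d * indicator U (x \<otimes> s))"
        if "x \<in> carrier G" for x
        using L assms(2) that sl[OF that, of L] unfolding covering_def by auto
    qed
    from covering_number_le[OF this, unfolded sw]
    show "covering_number U (\<lambda>x. f (x \<otimes> t)) \<le> sum_list (map fst L)" .
  qed
qed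

lemma covering_number_cong:
  assumes "\<And>x. x \<in> carrier G \<Longrightarrow> f x = g x"
  shows "covering_number U f = covering_number U g"
  using assms unfolding covering_number_def covering_def by simp

lemma covering_number_translate:
  assumes "f \<in> Cc_nonneg" "t \<in> carrier G"
  shows "covering_number U (\<lambda>x. f (x \<otimes> t)) = covering_number U f"
proof (rule antisym[OF covering_number_translate_le[OF assms]])
  have "covering_number U f = covering_number U (\<lambda>x. f (x \<otimes> inv t \<otimes> t))"
    using assms(2) by (intro covering_number_cong) (simp add: m_assoc)
  also have "\<dots> \<le> covering_number U (\<lambda>x. f (x \<otimes> t))"
    using covering_number_translate_le[of "\<lambda>x. f (x \<otimes> t)" "inv t"] Cc_nonneg_translate[OF assms] assms(2)
    by simp
  finally show "covering_number U f \<le> covering_number U (\<lambda>x. f (x \<otimes> t))" .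
qed

text \<open>At a single point each translate contributes at most its weight. This later makes the
  normalising denominators positive.\<close>

lemma covering_number_ge_value:
  assumes "f \<in> Cc_nonneg" "x \<in> carrier G"
  shows "f x \<le> covering_number U f"
proof -
  obtain L0 where L0: "covering U f L0" using covering_exists[OF assms(1) U] by blast
  show ?thesis
  proof (rule covering_number_ge[OF L0])
    fix L assume L: "covering U f L"
    have "(\<Sum>(d, s)\<leftarrow>R. d * indicator U (x \<otimes> s)) \<le> sum_list (map fst R)"
      if "set R \<subseteq> {0..} \<times> carrier G" for R :: "(real \<times> 'a) list"
      using that by (induction R) (auto simp: indicator_def)
    then show "f x \<le> sum_list (map fst L)"
      using L assms(2) unfolding covering_def by (meson order_trans)
  qed
qed

text \<open>Subadditivity, homogeneity and invariance, iterated along the list. Membership in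
  \<open>Cc_nonneg\<close> is part of the claim because the induction step applies subadditivity to
  the tail.\<close>

lemma covering_number_translates_bound:
  assumes "g \<in> Cc_nonneg" "set L \<subseteq> {0<..} \<times> carrier G"
  shows "(\<lambda>x. \<Sum>(c, s)\<leftarrow>L. c * g (x \<otimes> s)) \<in> Cc_nonneg \<and>
    covering_number U (\<lambda>x. \<Sum>(c, s)\<leftarrow>L. c * g (x \<otimes> s)) \<le> sum_list (map fst L) * covering_number U g"
  using assms(2)
proof (induction L)
  case Nil
  have "covering U (\<lambda>x. 0) []" by (simp add: covering_def)
  from covering_number_le[OF this] show ?case by (simp add: Cc_nonneg_zero)
next
  case (Cons p L)
  obtain c s where p: "p = (c, s)" "c > 0" "s \<in> carrier G" using Cons.prems by auto
  have g: "(\<lambda>x. g (x \<otimes> s)) \<in> Cc_nonneg" using Cc_nonneg_translate assms(1) p(3) .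
  have cg: "(\<lambda>x. c * g (x \<otimes> s)) \<in> Cc_nonneg" using Cc_nonneg_cmult[OF g] p(2) by simp
  have "covering_number U (\<lambda>x. c * g (x \<otimes> s)) = c * covering_number U g"
    using covering_number_cmult[OF g p(2)] covering_number_translate[OF assms(1) p(3)] by simp
  then show ?case
    using Cons covering_number_add[OF cg, of "\<lambda>x. \<Sum>(c, s)\<leftarrow>L. c * g (x \<otimes> s)"] Cc_nonneg_add[OF cg, of "\<lambda>x. \<Sum>(c, s)\<leftarrow>L. c * g (x \<otimes> s)"]
    by (simp add: p(1) algebra_simps)
qed

end

text \<open>Finitely many translates of the open set where \<open>g\<close> exceeds half of
  \<open>g a\<close> cover \<open>K\<close>; the weight \<open>2 / g a\<close> lifts that half to
  1.\<close>

lemma translates_ge_1_on_compact: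
  assumes K: "compactin T K" and g: "g \<in> Cc_nonneg" "a \<in> carrier G" "0 < g a"
  obtains L where "set L \<subseteq> {0<..} \<times> carrier G"
    "\<And>x. x \<in> K \<Longrightarrow> 1 \<le> (\<Sum>(c, s)\<leftarrow>L. c * g (x \<otimes> s))"
proof -
  define W where "W = {x \<in> carrier G. g x \<in> {g a / 2<..}}"
  have W: "openin T W" "W \<noteq> {}"
    using openin_continuous_map_preimage[OF Cc_nonneg_continuous[OF g(1)], of "{g a / 2<..}"] g
    unfolding W_def by auto
  obtain S where S: "set S \<subseteq> carrier G" "\<And>x. x \<in> K \<Longrightarrow> \<exists>s\<in>set S. x \<otimes> s \<in> W"
    using finite_translates_cover[OF K W] by metis
  define C where "C = 2 / g a"
  have C: "C > 0" using g(3) by (simp add: C_def)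
  show thesis
  proof
    show "set (map (\<lambda>s. (C, s)) S) \<subseteq> {0<..} \<times> carrier G" using C S(1) by auto
    fix x assume xK: "x \<in> K"
    then have x: "x \<in> carrier G" using compactin_subset_topspace[OF K] by auto
    have nn: "0 \<le> (\<Sum>s\<leftarrow>R. C * g (x \<otimes> s))" if "set R \<subseteq> carrier G" for R
      using C that x by (intro sum_list_nonneg) (auto intro!: mult_nonneg_nonneg Cc_nonneg_ge_0[OF g(1)])
    obtain s where s: "s \<in> set S" "x \<otimes> s \<in> W" using S(2) xK by blast
    then obtain S1 S2 where S12: "S = S1 @ s # S2" by (meson split_list)
    have "1 = C * (g a / 2)" using g(3) by (simp add: C_def)
    also have "\<dots> \<le> C * g (x \<otimes> s)" using s(2) C by (intro mult_left_mono) (auto simp: W_def)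
    finally show "1 \<le> (\<Sum>(c, s)\<leftarrow>map (\<lambda>s. (C, s)) S. c * g (x \<otimes> s))"
      using nn[of S1] nn[of S2] S(1) by (simp add: S12 o_def)
  qed
qed

text \<open>A combination \<open>?h\<close> of translates of \<open>g\<close> is at least 1 on the
  support of \<open>f\<close>, so a multiple of it dominates \<open>f\<close>. The point is that
  \<open>M\<close> does not depend on \<open>U\<close>: it bounds quotients of covering numbers
  uniformly as \<open>U\<close> shrinks.\<close>

lemma covering_number_comparable:
  assumes f: "f \<in> Cc_nonneg" and g: "g \<in> Cc_nonneg" "a \<in> carrier G" "0 < g a"
  obtains M where "0 \<le> M"
    "\<And>U. openin T U \<Longrightarrow> U \<noteq> {} \<Longrightarrow> covering_number U f \<le> M * covering_number U g"
proof -
  obtain K where K: "compactin T K" "{x \<in> carrier G. f x \<noteq> 0} \<subseteq> K"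
    using Cc_nonneg_support[OF f] by blast
  obtain L where L: "set L \<subseteq> {0<..} \<times> carrier G"
    "\<And>x. x \<in> K \<Longrightarrow> 1 \<le> (\<Sum>(c, s)\<leftarrow>L. c * g (x \<otimes> s))"
    using translates_ge_1_on_compact[OF K(1) g] by metis
  obtain B where B: "0 \<le> B" "\<And>x. x \<in> carrier G \<Longrightarrow> f x \<le> B"
    using Cc_nonneg_bounded[OF f] by metis
  let ?h = "\<lambda>x. \<Sum>(c, s)\<leftarrow>L. c * g (x \<otimes> s)"
  have h: "?h \<in> Cc_nonneg"
    using covering_number_translates_bound[OF openin_topspace _ g(1) L(1)] g(2) by auto
  \<comment> \<open>The factor \<open>B + 1\<close> instead of \<open>B\<close> is strictly
    positive, as homogeneity of the covering number requires.\<close>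
  have le: "f x \<le> (B + 1) * ?h x" if x: "x \<in> carrier G" for x
  proof (cases "x \<in> K")
    case True
    have "f x \<le> (B + 1) * 1" using B(2)[OF x] by simp
    also have "\<dots> \<le> (B + 1) * ?h x" using L(2)[OF True] B(1) by (intro mult_left_mono) auto
    finally show ?thesis .
  next
    case False
    then have "f x = 0" using K(2) x by blast
    then show ?thesis using Cc_nonneg_ge_0[OF h x] B(1) by simp
  qed
  show thesis
  proof
    show "0 \<le> (B + 1) * sum_list (map fst L)"
      using L(1) B(1) by (intro mult_nonneg_nonneg sum_list_nonneg) auto
    fix U assume U: "openin T U" "U \<noteq> {}"
    have "covering_number U f \<le> covering_number U (\<lambda>x. (B + 1) * ?h x)"
      using B(1) by (intro covering_number_mono[OF U _ le] Cc_nonneg_cmult[OF h]) auto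
    also have "\<dots> = (B + 1) * covering_number U ?h"
      using B(1) by (intro covering_number_cmult[OF U h]) auto
    also have "\<dots> \<le> (B + 1) * (sum_list (map fst L) * covering_number U g)"
      using covering_number_translates_bound[OF U g(1) L(1)] B(1) by (intro mult_left_mono) auto
    finally show "covering_number U f \<le> (B + 1) * sum_list (map fst L) * covering_number U g"
      by (simp add: mult.assoc)
  qed
qed


text \<open>With \<open>q = 1 / (f1 + f2 + \<delta>)\<close>, a covering of \<open>h = f1 + f2 + \<delta> g\<close>, where \<open>g \<ge> 1\<close> on the
  support, turns into coverings of \<open>f1\<close> and \<open>f2\<close> when its weights are multiplied by the values of
  \<open>q f1 + \<delta>\<close> and \<open>q f2 + \<delta>\<close> at the centres, because \<open>q f1\<close> and \<open>q f2\<close> are nearly constant on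
  the translates of a small \<open>U\<close>.\<close>

lemma covering_number_superadditive:
  assumes f: "f1 \<in> Cc_nonneg" "f2 \<in> Cc_nonneg"
    and f0: "f0 \<in> Cc_nonneg" "a \<in> carrier G" "0 < f0 a" and e: "0 < \<epsilon>"
  obtains V where "openin T V" "\<one> \<in> V"
    "\<And>U. openin T U \<Longrightarrow> \<one> \<in> U \<Longrightarrow> U \<subseteq> V \<Longrightarrow> covering_number U f1 + covering_number U f2
        \<le> covering_number U (\<lambda>x. f1 x + f2 x) + \<epsilon> * covering_number U f0"
proof -
  have fs: "(\<lambda>x. f1 x + f2 x) \<in> Cc_nonneg" using Cc_nonneg_add[OF f] .
  obtain K where K: "compactin T K" "{x \<in> carrier G. f1 x + f2 x \<noteq> 0} \<subseteq> K"
    using Cc_nonneg_support[OF fs] by blast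
  obtain L0 where L0: "set L0 \<subseteq> {0<..} \<times> carrier G"
    "\<And>x. x \<in> K \<Longrightarrow> 1 \<le> (\<Sum>(c, s)\<leftarrow>L0. c * f0 (x \<otimes> s))"
    using translates_ge_1_on_compact[OF K(1) f0] by metis
  define g where "g = (\<lambda>x. \<Sum>(c, s)\<leftarrow>L0. c * f0 (x \<otimes> s))"
  have g: "g \<in> Cc_nonneg"
    unfolding g_def using covering_number_translates_bound[OF openin_topspace _ f0(1) L0(1)] f0(2) by auto
  have g1: "1 \<le> g x" if "x \<in> K" for x unfolding g_def using L0(2) that .
  obtain M where M: "0 \<le> M" "\<And>U. openin T U \<Longrightarrow> U \<noteq> {} \<Longrightarrow>
      covering_number U (\<lambda>x. f1 x + f2 x) \<le> M * covering_number U f0"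
    using covering_number_comparable[OF fs f0] by blast
  obtain N where N: "0 \<le> N" "\<And>U. openin T U \<Longrightarrow> U \<noteq> {} \<Longrightarrow>
      covering_number U g \<le> N * covering_number U f0"
    using covering_number_comparable[OF g f0] by blast
  \<comment> \<open>The total error will be \<open>\<delta> * (2 * M + 3 * N)\<close> times the
    covering number of \<open>f0\<close>: \<open>2 * M\<close> comes from the factor
    \<open>1 + 2 * \<delta>\<close> on \<open>f1 + f2\<close>, \<open>N\<close> from the summand
    \<open>\<delta> * g\<close>, and \<open>2 * N\<close> from their product, where
    \<open>\<delta> \<le> 1\<close> is used. The added 1 keeps the denominator positive when
    \<open>M\<close> and \<open>N\<close> vanish.\<close>
  define \<delta> where "\<delta> = min 1 (\<epsilon> / (2 * M + 3 * N + 1))"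
  have \<delta>: "0 < \<delta>" "\<delta> \<le> 1" "\<delta> * (2 * M + 3 * N) \<le> \<epsilon>"
  proof -
    show "0 < \<delta>" using e M(1) N(1) by (simp add: \<delta>_def add_nonneg_pos)
    show "\<delta> \<le> 1" by (simp add: \<delta>_def)
    have "\<delta> * (2 * M + 3 * N) \<le> (\<epsilon> / (2 * M + 3 * N + 1)) * (2 * M + 3 * N + 1)"
      using M(1) N(1) e by (intro mult_mono) (auto simp: \<delta>_def)
    also have "\<dots> = \<epsilon>" using M(1) N(1) by (simp add: add_nonneg_eq_0_iff)
    finally show "\<delta> * (2 * M + 3 * N) \<le> \<epsilon>" .
  qed
  define h where "h = (\<lambda>x. (f1 x + f2 x) + \<delta> * g x)"
  have dg: "(\<lambda>x. \<delta> * g x) \<in> Cc_nonneg" using Cc_nonneg_cmult[OF g] \<delta>(1) by simp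
  have h: "h \<in> Cc_nonneg" unfolding h_def using Cc_nonneg_add[OF fs dg] .
  define q where "q = (\<lambda>x. 1 / (f1 x + f2 x + \<delta>))"
  have den: "0 < f1 x + f2 x + \<delta>" if "x \<in> carrier G" for x
    using Cc_nonneg_ge_0[OF fs that] \<delta>(1) by simp
  have q: "continuous_map T euclideanreal q"
    unfolding q_def
  proof (rule continuous_map_real_divide)
    show "continuous_map T euclideanreal (\<lambda>x. f1 x + f2 x + \<delta>)"
      by (rule continuous_map_add[OF Cc_nonneg_continuous[OF fs]]) simp
    show "f1 x + f2 x + \<delta> \<noteq> 0" if "x \<in> topspace T" for x
      using den[of x] that by simp
  qed simp
  have q0: "0 \<le> q x" if "x \<in> carrier G" for x using den[OF that] by (simp add: q_def)
  have key: "\<exists>V. openin T V \<and> \<one> \<in> V \<and>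
      (\<forall>v\<in>V. \<forall>x\<in>carrier G. \<bar>q (v \<otimes> x) * fi (v \<otimes> x) - q x * fi x\<bar> < \<delta>)"
    if fi: "fi \<in> Cc_nonneg" for fi
  proof -
    have qf: "(\<lambda>x. q x * fi x) \<in> Cc_nonneg" using Cc_nonneg_mult[OF fi q q0] .
    obtain C where C: "compactin T C" "{x \<in> carrier G. q x * fi x \<noteq> 0} \<subseteq> C"
      using Cc_nonneg_support[OF qf] by blast
    show ?thesis
      using uniformly_continuous_left[OF Cc_nonneg_continuous[OF qf] C \<delta>(1)] by metis
  qed
  obtain V1 where V1: "openin T V1" "\<one> \<in> V1"
     "\<forall>v\<in>V1. \<forall>x\<in>carrier G. \<bar>q (v \<otimes> x) * f1 (v \<otimes> x) - q x * f1 x\<bar> < \<delta>"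
    using key[OF f(1)] by blast
  obtain V2 where V2: "openin T V2" "\<one> \<in> V2"
     "\<forall>v\<in>V2. \<forall>x\<in>carrier G. \<bar>q (v \<otimes> x) * f2 (v \<otimes> x) - q x * f2 x\<bar> < \<delta>"
    using key[OF f(2)] by blast
  show thesis
  proof
    show "openin T (V1 \<inter> V2)" "\<one> \<in> V1 \<inter> V2" using V1 V2 by auto
    fix U assume U: "openin T U" "\<one> \<in> U" "U \<subseteq> V1 \<inter> V2"
    then have Une: "U \<noteq> {}" by blast
    obtain Lh where Lh: "covering U h Lh" using covering_exists[OF h U(1) Une] by blast
    have "(covering_number U f1 + covering_number U f2) / (1 + 2 * \<delta>) \<le> covering_number U h"
    proof (rule covering_number_ge[OF Lh])
      fix L assume L: "covering U h L"
      have Ls: "set L \<subseteq> {0..} \<times> carrier G" using L by (simp add: covering_def)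
      \<comment> \<open>\<open>x \<otimes> s \<in> U\<close> means that
        \<open>x = u \<otimes> inv s\<close> with \<open>u\<close> in \<open>U\<close>. Hence the
        centre is \<open>inv s\<close>, and left uniform continuity compares the values of
        \<open>q * fi\<close> at \<open>x\<close> and at the centre, with an error below
        \<open>\<delta>\<close>.\<close>
      define L' where "L' = (\<lambda>fi. map (\<lambda>(c, s). (c * (q (inv s) * fi (inv s) + \<delta>), s)) L)"
      have cov: "covering U fi (L' fi)"
        if fi: "fi \<in> Cc_nonneg" "\<And>x. x \<in> carrier G \<Longrightarrow> x \<notin> K \<Longrightarrow> fi x = 0"
          and uc: "\<forall>v\<in>U. \<forall>x\<in>carrier G. \<bar>q (v \<otimes> x) * fi (v \<otimes> x) - q x * fi x\<bar> < \<delta>" for fi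
      proof (rule coveringI)
        have "0 \<le> c * (q (inv s) * fi (inv s) + \<delta>) \<and> s \<in> carrier G" if "(c, s) \<in> set L" for c s
        proof -
          have cs: "0 \<le> c" "s \<in> carrier G" using Ls that by auto
          then have "0 \<le> q (inv s) * fi (inv s)" using q0 Cc_nonneg_ge_0[OF fi(1)] by simp
          then show ?thesis using cs \<delta>(1) by simp
        qed
        then show "set (L' fi) \<subseteq> {0..} \<times> carrier G" by (auto simp: L'_def)
        fix x assume x: "x \<in> carrier G"
        have qf: "0 \<le> q x * fi x" using q0 x Cc_nonneg_ge_0[OF fi(1)] by simp
        have "fi x \<le> (q x * fi x) * h x"
        proof (cases "x \<in> K")
          case True
          have "fi x = (q x * fi x) * (f1 x + f2 x + \<delta> * 1)" using den[OF x] by (simp add: q_def)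
          also have "\<dots> \<le> (q x * fi x) * h x"
            unfolding h_def using g1[OF True] \<delta>(1) by (intro mult_left_mono qf add_left_mono) auto
          finally show ?thesis .
        next
          case False
          then show ?thesis using fi(2) x by simp
        qed
        also have "\<dots> \<le> (q x * fi x) * (\<Sum>(c, s)\<leftarrow>L. c * indicator U (x \<otimes> s))"
          using L x qf unfolding covering_def by (intro mult_left_mono) auto
        also have "\<dots> = (\<Sum>(c, s)\<leftarrow>L. c * (q x * fi x) * indicator U (x \<otimes> s))"
          by (induction L) (auto simp: algebra_simps)
        also have "\<dots> \<le> (\<Sum>(c, s)\<leftarrow>L. c * (q (inv s) * fi (inv s) + \<delta>) * indicator U (x \<otimes> s))"
        proof (rule sum_list_mono, clarify)
          fix c s assume "(c, s) \<in> set L"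
          then have cs: "0 \<le> c" "s \<in> carrier G" using Ls by auto
          show "c * (q x * fi x) * indicator U (x \<otimes> s)
            \<le> c * (q (inv s) * fi (inv s) + \<delta>) * indicator U (x \<otimes> s)"
          proof (cases "x \<otimes> s \<in> U")
            case True
            have "x \<otimes> s \<otimes> inv s = x" using x cs(2) by (simp add: m_assoc)
            then have "\<bar>q x * fi x - q (inv s) * fi (inv s)\<bar> < \<delta>"
              using uc[rule_format, OF True, of "inv s"] cs(2) by simp
            then have "q x * fi x \<le> q (inv s) * fi (inv s) + \<delta>" by linarith
            then show ?thesis using cs(1) True by (simp add: mult_left_mono)
          qed simp
        qed
        also have "\<dots> = (\<Sum>(c, s)\<leftarrow>L' fi. c * indicator U (x \<otimes> s))"
          unfolding L'_def by (induction L) auto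
        finally show "fi x \<le> (\<Sum>(c, s)\<leftarrow>L' fi. c * indicator U (x \<otimes> s))" .
      qed
      have sub: "f1 x = 0" "f2 x = 0" if "x \<in> carrier G" "x \<notin> K" for x
      proof -
        have "f1 x + f2 x = 0" using K(2) that by blast
        then show "f1 x = 0" "f2 x = 0"
          using Cc_nonneg_ge_0[OF f(1) that(1)] Cc_nonneg_ge_0[OF f(2) that(1)] by auto
      qed
      have c1: "covering U f1 (L' f1)" using U(3) V1(3) by (intro cov f sub) auto
      have c2: "covering U f2 (L' f2)" using U(3) V2(3) by (intro cov f sub) auto
      have "sum_list (map fst (L' f1)) + sum_list (map fst (L' f2))
          = (\<Sum>(c, s)\<leftarrow>L. c * (q (inv s) * (f1 (inv s) + f2 (inv s)) + 2 * \<delta>))"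
        unfolding L'_def by (induction L) (auto simp: algebra_simps)
      also have "\<dots> \<le> (\<Sum>(c, s)\<leftarrow>L. c * (1 + 2 * \<delta>))"
      proof (rule sum_list_mono, clarify)
        fix c s assume "(c, s) \<in> set L"
        then have cs: "0 \<le> c" "s \<in> carrier G" using Ls by auto
        have "q (inv s) * (f1 (inv s) + f2 (inv s)) \<le> 1"
          using den[of "inv s"] cs(2) \<delta>(1) by (simp add: q_def divide_le_eq)
        then show "c * (q (inv s) * (f1 (inv s) + f2 (inv s)) + 2 * \<delta>) \<le> c * (1 + 2 * \<delta>)"
          using cs(1) by (intro mult_left_mono) auto
      qed
      also have "\<dots> = (1 + 2 * \<delta>) * sum_list (map fst L)"
        by (induction L) (auto simp: algebra_simps)
      finally have "covering_number U f1 + covering_number U f2 \<le> (1 + 2 * \<delta>) * sum_list (map fst L)"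
        using covering_number_le[OF c1] covering_number_le[OF c2] by linarith
      then show "(covering_number U f1 + covering_number U f2) / (1 + 2 * \<delta>) \<le> sum_list (map fst L)"
        using \<delta>(1) by (simp add: pos_divide_le_eq mult.commute)
    qed
    then have 1: "covering_number U f1 + covering_number U f2 \<le> (1 + 2 * \<delta>) * covering_number U h"
      using \<delta>(1) by (simp add: pos_divide_le_eq mult.commute)
    define S where "S = covering_number U (\<lambda>x. f1 x + f2 x)"
    define F where "F = covering_number U f0"
    have S: "S \<le> M * F" using M(2)[OF U(1) Une] by (simp add: S_def F_def)
    have F: "0 \<le> F" using covering_number_ge_value[OF U(1) Une f0(1,2)] f0(3) by (simp add: F_def)
    have "covering_number U h \<le> S + covering_number U (\<lambda>x. \<delta> * g x)"
      unfolding h_def S_def using covering_number_add[OF U(1) Une fs dg] .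
    also have "\<dots> = S + \<delta> * covering_number U g"
      using covering_number_cmult[OF U(1) Une g \<delta>(1)] by simp
    also have "\<dots> \<le> S + \<delta> * (N * F)"
      using N(2)[OF U(1) Une] \<delta>(1) by (intro add_left_mono mult_left_mono) (auto simp: F_def)
    finally have "(1 + 2 * \<delta>) * covering_number U h \<le> (1 + 2 * \<delta>) * (S + \<delta> * (N * F))"
      using \<delta>(1) by (intro mult_left_mono) auto
    also have "\<dots> = S + 2 * \<delta> * S + \<delta> * (N * F) + 2 * \<delta> * (\<delta> * (N * F))"
      by (simp add: algebra_simps)
    also have "\<dots> \<le> S + 2 * \<delta> * (M * F) + \<delta> * (N * F) + 2 * 1 * (\<delta> * (N * F))"
    proof -
      have "2 * \<delta> * S \<le> 2 * \<delta> * (M * F)" using S \<delta>(1) by (intro mult_left_mono) auto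
      moreover have "2 * \<delta> * (\<delta> * (N * F)) \<le> 2 * 1 * (\<delta> * (N * F))"
        using \<delta>(1,2) N(1) F by (intro mult_right_mono) auto
      ultimately show ?thesis by linarith
    qed
    also have "\<dots> = S + (\<delta> * (2 * M + 3 * N)) * F" by (simp add: algebra_simps)
    also have "\<dots> \<le> S + \<epsilon> * F" using \<delta>(3) F by (intro add_left_mono mult_right_mono)
    finally show "covering_number U f1 + covering_number U f2
        \<le> covering_number U (\<lambda>x. f1 x + f2 x) + \<epsilon> * covering_number U f0"
      using 1 by (simp add: S_def F_def)
  qed
qed

end

subsection \<open>Existence of a Haar functional\<close>

context topological_group
begin

text \<open>The filter that expresses the limit along open neighbourhoods of the unit as they
  shrink.\<close>

definition small_neighbourhoods :: "'a set filter" where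
  "small_neighbourhoods =
     (INF V\<in>{V. openin T V \<and> \<one> \<in> V}. principal {U. openin T U \<and> \<one> \<in> U \<and> U \<subseteq> V})"

lemma eventually_small_neighbourhoods:
  "eventually P small_neighbourhoods \<longleftrightarrow>
     (\<exists>V. openin T V \<and> \<one> \<in> V \<and> (\<forall>U. openin T U \<and> \<one> \<in> U \<and> U \<subseteq> V \<longrightarrow> P U))"
  unfolding small_neighbourhoods_def
proof (subst eventually_INF_base)
  have "openin T (carrier G)" using openin_topspace[of T] by simp
  then show "{V. openin T V \<and> \<one> \<in> V} \<noteq> {}" by blast
next
  fix A B assume "A \<in> {V. openin T V \<and> \<one> \<in> V}" "B \<in> {V. openin T V \<and> \<one> \<in> V}"
  then show "\<exists>C\<in>{V. openin T V \<and> \<one> \<in> V}.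
      principal {U. openin T U \<and> \<one> \<in> U \<and> U \<subseteq> C}
      \<le> inf (principal {U. openin T U \<and> \<one> \<in> U \<and> U \<subseteq> A}) (principal {U. openin T U \<and> \<one> \<in> U \<and> U \<subseteq> B})"
    by (intro bexI[of _ "A \<inter> B"]) auto
qed (auto simp: eventually_principal)

text \<open>The restriction of a right Haar integral to the cone \<open>Cc_nonneg\<close>, without a
  normalisation. The last clause excludes the zero functional and says that nonempty open sets have
  positive mass.\<close>

definition haar_functional :: "(('a \<Rightarrow> real) \<Rightarrow> real) \<Rightarrow> bool" where
  "haar_functional J \<longleftrightarrow>
     (\<forall>f\<in>Cc_nonneg. \<forall>g\<in>Cc_nonneg. J (\<lambda>x. f x + g x) = J f + J g) \<and>
     (\<forall>f\<in>Cc_nonneg. \<forall>c>0. J (\<lambda>x. c * f x) = c * J f) \<and>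
     (\<forall>f\<in>Cc_nonneg. \<forall>g\<in>Cc_nonneg. (\<forall>x\<in>carrier G. f x \<le> g x) \<longrightarrow> J f \<le> J g) \<and>
     (\<forall>f\<in>Cc_nonneg. \<forall>t\<in>carrier G. J (\<lambda>x. f (x \<otimes> t)) = J f) \<and>
     (\<forall>f\<in>Cc_nonneg. \<forall>x\<in>carrier G. 0 < f x \<longrightarrow> 0 < J f)"

text \<open>The functional is a cluster point, in a product of compact intervals, of the normalised
  covering numbers as \<open>U\<close> shrinks to the unit.\<close>

lemma haar_functional_exists:
  assumes f0: "f0 \<in> Cc_nonneg" "a \<in> carrier G" "0 < f0 a"
  obtains J where "haar_functional J"
proof -
  \<comment> \<open>The value 0 outside the cone makes each \<open>I U\<close> a function on all of
    \<open>'a \<Rightarrow> real\<close> with bounded coordinates, hence a point of the product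
    \<open>X\<close> of compact intervals.\<close>
  define I where "I = (\<lambda>U f. if f \<in> Cc_nonneg then covering_number U f / covering_number U f0 else 0)"
  have I: "I U f = covering_number U f / covering_number U f0" if "f \<in> Cc_nonneg" for U f
    using that by (simp add: I_def)
  have pos0: "0 < covering_number U f0" if "openin T U" "U \<noteq> {}" for U
    using covering_number_ge_value[OF that f0(1,2)] f0(3) by simp
  have "\<exists>M. \<forall>U. openin T U \<longrightarrow> U \<noteq> {} \<longrightarrow> 0 \<le> I U f \<and> I U f \<le> M" for f
  proof (cases "f \<in> Cc_nonneg")
    case True
    obtain M where M: "\<And>U. openin T U \<Longrightarrow> U \<noteq> {} \<Longrightarrow> covering_number U f \<le> M * covering_number U f0"
      using covering_number_comparable[OF True f0] by blast
    show ?thesis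
    proof (intro exI[of _ M] allI impI)
      fix U assume U: "openin T U" "U \<noteq> {}"
      have "0 \<le> covering_number U f"
        using covering_number_ge_value[OF U True f0(2)] Cc_nonneg_ge_0[OF True f0(2)] by linarith
      then show "0 \<le> I U f \<and> I U f \<le> M"
        using M[OF U] pos0[OF U] by (simp add: I[OF True] pos_divide_le_eq)
    qed
  next
    case False
    then show ?thesis by (intro exI[of _ 0]) (simp add: I_def)
  qed
  then obtain M where M: "\<And>f U. openin T U \<Longrightarrow> U \<noteq> {} \<Longrightarrow> 0 \<le> I U f \<and> I U f \<le> M f"
    by metis
  define X where "X = (PiE UNIV (\<lambda>f. {0..M f}))"
  have "compactin (product_topology (\<lambda>f::'a \<Rightarrow> real. euclideanreal) UNIV) X"
    unfolding X_def by (subst compactin_PiE) auto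
  then have X: "compact X" by (simp add: euclidean_product_topology)
  define \<F> where "\<F> = filtermap I small_neighbourhoods"
  have ev_open: "eventually (\<lambda>U. openin T U \<and> U \<noteq> {} \<and> P U) small_neighbourhoods"
    if "openin T V" "\<one> \<in> V" "\<And>U. openin T U \<Longrightarrow> \<one> \<in> U \<Longrightarrow> U \<subseteq> V \<Longrightarrow> P U" for V P
    unfolding eventually_small_neighbourhoods using that by blast
  have ev: "eventually P small_neighbourhoods"
    if "\<And>U. openin T U \<Longrightarrow> U \<noteq> {} \<Longrightarrow> P U" for P
    unfolding eventually_small_neighbourhoods
    using that openin_topspace[of T] by (intro exI[of _ "topspace T"]) auto
  have "small_neighbourhoods \<noteq> bot"
    unfolding trivial_limit_def eventually_small_neighbourhoods by auto
  then have "\<F> \<noteq> bot" by (simp add: \<F>_def filtermap_bot_iff)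
  moreover have "eventually (\<lambda>j. j \<in> X) \<F>"
    unfolding \<F>_def eventually_filtermap
  proof (rule ev)
    fix U assume "openin T U" "U \<noteq> {}"
    then show "I U \<in> X" using M[of U] by (auto simp: X_def PiE_UNIV_domain)
  qed
  ultimately obtain J where J: "inf (nhds J) \<F> \<noteq> bot"
    using X unfolding compact_filter by blast
  \<comment> \<open>\<open>H\<close> refines both the neighbourhoods of the cluster point
    \<open>J\<close> and the image filter \<open>\<F>\<close>: coordinates converge to those of
    \<open>J\<close> along \<open>H\<close>, and whatever holds for all small \<open>U\<close> holds
    eventually along \<open>H\<close>. Each property of \<open>J\<close> is then a limit of a
    property of \<open>I U\<close>.\<close>
  define H where "H = inf (nhds J) \<F>"
  have H: "H \<noteq> bot" using J by (simp add: H_def)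
  have evH: "eventually P H" if "eventually (\<lambda>U. P (I U)) small_neighbourhoods" for P
    using that by (intro filter_leD[of H \<F>]) (auto simp: H_def \<F>_def eventually_filtermap)
  have lim: "((\<lambda>j. j f) \<longlongrightarrow> J f) H" for f
  proof -
    have "((\<lambda>j. j f) \<longlongrightarrow> J f) (nhds J)"
    proof (rule topological_tendstoI)
      fix S :: "real set" assume S: "open S" "J f \<in> S"
      have "open ((\<lambda>j. j f) -` S)"
        using S(1) continuous_on_product_coordinates by (rule open_vimage)
      then show "eventually (\<lambda>j. j f \<in> S) (nhds J)"
        using S(2) unfolding eventually_nhds by (intro exI[of _ "(\<lambda>j. j f) -` S"]) auto
    qed
    then show ?thesis by (rule tendsto_mono[rotated]) (simp add: H_def)
  qed
  show thesis
  proof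
    show "haar_functional J"
      unfolding haar_functional_def
    proof (intro conjI ballI allI impI)
      fix f g assume f: "f \<in> Cc_nonneg" and g: "g \<in> Cc_nonneg"
      note fg = Cc_nonneg_add[OF f g]
      show "J (\<lambda>x. f x + g x) = J f + J g"
      proof (rule antisym)
        show "J (\<lambda>x. f x + g x) \<le> J f + J g"
        proof (rule tendsto_le[OF H tendsto_add[OF lim lim] lim], rule evH, rule ev)
          fix U assume U: "openin T U" "U \<noteq> {}"
          show "I U (\<lambda>x. f x + g x) \<le> I U f + I U g"
            using covering_number_add[OF U f g] pos0[OF U]
            by (simp add: I f g fg add_divide_distrib[symmetric] divide_right_mono)
        qed
        show "J f + J g \<le> J (\<lambda>x. f x + g x)"
        \<comment> \<open>Covering numbers are superadditive only up to an error \<open>e\<close>,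
          and only for \<open>U\<close> inside a neighbourhood depending on \<open>e\<close>; the
          error is removed after the limit.\<close>
        proof (rule field_le_epsilon)
          fix e :: real assume e: "e > 0"
          obtain V where V: "openin T V" "\<one> \<in> V"
            "\<And>U. openin T U \<Longrightarrow> \<one> \<in> U \<Longrightarrow> U \<subseteq> V \<Longrightarrow> covering_number U f + covering_number U g
                \<le> covering_number U (\<lambda>x. f x + g x) + e * covering_number U f0"
            using covering_number_superadditive[OF f g f0 e] by blast
          show "J f + J g \<le> J (\<lambda>x. f x + g x) + e"
          proof (rule tendsto_le[OF H tendsto_add[OF lim tendsto_const] tendsto_add[OF lim lim]], rule evH)
            have step: "I U f + I U g \<le> I U (\<lambda>x. f x + g x) + e"
              if U: "openin T U" "U \<noteq> {}" and le: "covering_number U f + covering_number U g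
                \<le> covering_number U (\<lambda>x. f x + g x) + e * covering_number U f0" for U
            proof -
              have "(covering_number U f + covering_number U g) / covering_number U f0
                \<le> (covering_number U (\<lambda>x. f x + g x) + e * covering_number U f0) / covering_number U f0"
                using le pos0[OF U] by (intro divide_right_mono) auto
              then show ?thesis using pos0[OF U] by (simp add: I f g fg add_divide_distrib)
            qed
            have "eventually (\<lambda>U. openin T U \<and> U \<noteq> {} \<and> covering_number U f + covering_number U g
                \<le> covering_number U (\<lambda>x. f x + g x) + e * covering_number U f0) small_neighbourhoods"
              by (rule ev_open[OF V])
            then show "eventually (\<lambda>U. I U f + I U g \<le> I U (\<lambda>x. f x + g x) + e) small_neighbourhoods"
              by (rule eventually_mono) (elim conjE, rule step)
          qed
        qed
      qed
    next
      fix f and c :: real assume f: "f \<in> Cc_nonneg" and c: "c > 0"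
      have "((\<lambda>j. j (\<lambda>x. c * f x) - c * j f) \<longlongrightarrow> J (\<lambda>x. c * f x) - c * J f) H"
        by (intro tendsto_intros lim)
      \<comment> \<open>An identity that holds for every \<open>I U\<close> makes this difference
        vanish eventually, so its limit is 0. Translation invariance is obtained in the same
        way.\<close>
      moreover have "((\<lambda>j. j (\<lambda>x. c * f x) - c * j f) \<longlongrightarrow> 0) H"
      proof (rule tendsto_eventually, rule evH, rule ev)
        fix U assume U: "openin T U" "U \<noteq> {}"
        show "I U (\<lambda>x. c * f x) - c * I U f = 0"
          using covering_number_cmult[OF U f c] Cc_nonneg_cmult[OF f] c by (simp add: I f)
      qed
      ultimately have "J (\<lambda>x. c * f x) - c * J f = 0" by (rule tendsto_unique[OF H])
      then show "J (\<lambda>x. c * f x) = c * J f" by simp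
    next
      fix f g assume f: "f \<in> Cc_nonneg" and g: "g \<in> Cc_nonneg" and le: "\<forall>x\<in>carrier G. f x \<le> g x"
      show "J f \<le> J g"
      proof (rule tendsto_le[OF H lim lim], rule evH, rule ev)
        fix U assume U: "openin T U" "U \<noteq> {}"
        show "I U f \<le> I U g"
          using covering_number_mono[OF U g, of f] le pos0[OF U] by (simp add: I f g divide_right_mono)
      qed
    next
      fix f t assume f: "f \<in> Cc_nonneg" and t: "t \<in> carrier G"
      have "((\<lambda>j. j (\<lambda>x. f (x \<otimes> t)) - j f) \<longlongrightarrow> J (\<lambda>x. f (x \<otimes> t)) - J f) H"
        by (intro tendsto_intros lim)
      moreover have "((\<lambda>j. j (\<lambda>x. f (x \<otimes> t)) - j f) \<longlongrightarrow> 0) H"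
      proof (rule tendsto_eventually, rule evH, rule ev)
        fix U assume U: "openin T U" "U \<noteq> {}"
        show "I U (\<lambda>x. f (x \<otimes> t)) - I U f = 0"
          using covering_number_translate[OF U f t] Cc_nonneg_translate[OF f t] by (simp add: I f)
      qed
      ultimately have "J (\<lambda>x. f (x \<otimes> t)) - J f = 0" by (rule tendsto_unique[OF H])
      then show "J (\<lambda>x. f (x \<otimes> t)) = J f" by simp
    next
      fix f x assume f: "f \<in> Cc_nonneg" and x: "x \<in> carrier G" "0 < f x"
      obtain C where C: "0 \<le> C" "\<And>U. openin T U \<Longrightarrow> U \<noteq> {} \<Longrightarrow>
          covering_number U f0 \<le> C * covering_number U f"
        using covering_number_comparable[OF f0(1) f x] by blast
      \<comment> \<open>The normalisation gives \<open>f0\<close> the value 1, and comparing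
        \<open>f0\<close> with \<open>f\<close> bounds \<open>I U f\<close> away from 0 uniformly in
        \<open>U\<close>.\<close>
      have "1 \<le> C * J f"
      proof (rule tendsto_le[OF H tendsto_mult[OF tendsto_const lim] tendsto_const], rule evH, rule ev)
        fix U assume U: "openin T U" "U \<noteq> {}"
        show "1 \<le> C * I U f"
          using C(2)[OF U] pos0[OF U] by (simp add: I f pos_le_divide_eq)
      qed
      then show "0 < J f" using C(1) mult_nonneg_nonpos[of C "J f"] by linarith
    qed
  qed
qed

end

subsection \<open>Autocorrelations and Schur products\<close>

context topological_group
begin

lemma haar_functionalD:
  assumes "haar_functional J"
  shows haar_add: "f \<in> Cc_nonneg \<Longrightarrow> g \<in> Cc_nonneg \<Longrightarrow> J (\<lambda>x. f x + g x) = J f + J g"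
    and haar_cmult_pos: "f \<in> Cc_nonneg \<Longrightarrow> 0 < c \<Longrightarrow> J (\<lambda>x. c * f x) = c * J f"
    and haar_mono: "f \<in> Cc_nonneg \<Longrightarrow> g \<in> Cc_nonneg \<Longrightarrow> (\<And>x. x \<in> carrier G \<Longrightarrow> f x \<le> g x) \<Longrightarrow> J f \<le> J g"
    and haar_translate: "f \<in> Cc_nonneg \<Longrightarrow> t \<in> carrier G \<Longrightarrow> J (\<lambda>x. f (x \<otimes> t)) = J f"
    and haar_pos: "f \<in> Cc_nonneg \<Longrightarrow> x \<in> carrier G \<Longrightarrow> 0 < f x \<Longrightarrow> 0 < J f"
  using assms unfolding haar_functional_def by blast+

section \<open>Linearity and positivity of a fixed Haar functional\<close>

context
  fixes J assumes J: "haar_functional J"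
begin

lemma haar_cong:
  assumes "f \<in> Cc_nonneg" "g \<in> Cc_nonneg" "\<And>x. x \<in> carrier G \<Longrightarrow> f x = g x"
  shows "J f = J g"
  by (rule antisym; rule haar_mono[OF J]) (use assms in auto)

lemma haar_zero: "J (\<lambda>x. 0) = 0"
  using haar_add[OF J Cc_nonneg_zero Cc_nonneg_zero] by simp

lemma haar_cmult: "f \<in> Cc_nonneg \<Longrightarrow> 0 \<le> c \<Longrightarrow> J (\<lambda>x. c * f x) = c * J f"
  using haar_cmult_pos[OF J, of f c] haar_zero by (cases "c = 0") auto

lemma haar_nonneg: "f \<in> Cc_nonneg \<Longrightarrow> 0 \<le> J f"
  using haar_mono[OF J Cc_nonneg_zero, of f] Cc_nonneg_ge_0 haar_zero by simp

lemma haar_sum: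
  assumes "finite A" "\<And>i. i \<in> A \<Longrightarrow> h i \<in> Cc_nonneg"
  shows "J (\<lambda>x. \<Sum>i\<in>A. h i x) = (\<Sum>i\<in>A. J (h i))"
  using assms
proof (induction A rule: finite_induct)
  case (insert a A)
  have "(\<lambda>x. \<Sum>i\<in>A. h i x) \<in> Cc_nonneg" using insert.prems by (intro Cc_nonneg_sum) simp
  then have "J (\<lambda>x. h a x + (\<Sum>i\<in>A. h i x)) = J (h a) + J (\<lambda>x. \<Sum>i\<in>A. h i x)"
    using insert.prems by (intro haar_add[OF J]) auto
  then show ?case using insert by simp
qed (simp add: haar_zero)

text \<open>\<open>J\<close> acts on a cone only, so the coefficients are split into positive and
  negative parts. The combination is \<open>P 1 - P (-1)\<close> with both terms in the cone, and
  monotonicity compares their values under \<open>J\<close>.\<close>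

lemma haar_linear_combination_nonneg:
  assumes A: "finite A" and h: "\<And>i. i \<in> A \<Longrightarrow> h i \<in> Cc_nonneg"
    and nn: "\<And>x. x \<in> carrier G \<Longrightarrow> 0 \<le> (\<Sum>i\<in>A. r i * h i x)"
  shows "0 \<le> (\<Sum>i\<in>A. r i * J (h i))"
proof -
  define P where "P = (\<lambda>s x. \<Sum>i\<in>A. max (s * r i) 0 * h i x)"
  have hc: "(\<lambda>x. max (s * r i) 0 * h i x) \<in> Cc_nonneg" if "i \<in> A" for i s
    using Cc_nonneg_cmult[OF h[OF that]] by simp
  have P: "P s \<in> Cc_nonneg" for s unfolding P_def using hc by (rule Cc_nonneg_sum)
  have JP: "J (P s) = (\<Sum>i\<in>A. max (s * r i) 0 * J (h i))" for s
  proof -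
    have "J (P s) = (\<Sum>i\<in>A. J (\<lambda>x. max (s * r i) 0 * h i x))"
      unfolding P_def using A hc by (rule haar_sum)
    also have "\<dots> = (\<Sum>i\<in>A. max (s * r i) 0 * J (h i))"
      by (intro sum.cong refl haar_cmult h) auto
    finally show ?thesis .
  qed
  have split: "r i * t = max (1 * r i) 0 * t - max (-1 * r i) 0 * t" for i t
    by (auto simp: max_def)
  have "P (-1) x \<le> P 1 x" if "x \<in> carrier G" for x
  proof -
    have "(\<Sum>i\<in>A. r i * h i x) = P 1 x - P (-1) x"
      unfolding P_def sum_subtractf[symmetric] by (rule sum.cong[OF refl split])
    then show ?thesis using nn[OF that] by simp
  qed
  then have "J (P (-1)) \<le> J (P 1)" by (rule haar_mono[OF J P P])
  moreover have "(\<Sum>i\<in>A. r i * J (h i)) = J (P 1) - J (P (-1))"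
    unfolding JP sum_subtractf[symmetric] by (rule sum.cong[OF refl split])
  ultimately show ?thesis by simp
qed

text \<open>Right translation by \<open>inv (x q)\<close> turns the autocorrelation at
  \<open>x p \<otimes> inv (x q)\<close> into \<open>J\<close> of the product
  \<open>h (p, q)\<close>, a Gram kernel. For fixed \<open>y\<close> the sum is then the quadratic
  form of \<open>\<Phi>\<close> with coefficients \<open>g (y \<otimes> inv (x p))\<close>, hence
  nonnegative, and \<open>J\<close> preserves this.\<close>

lemma haar_autocorrelation_schur:
  fixes x :: "'i \<Rightarrow> 'a" and \<Phi> :: "'i \<Rightarrow> 'i \<Rightarrow> complex"
  assumes g: "g \<in> Cc_nonneg" and A: "finite A" and x: "\<And>p. p \<in> A \<Longrightarrow> x p \<in> carrier G"
    and pd: "\<And>c. (\<Sum>p\<in>A. \<Sum>q\<in>A. c p * cnj (c q) * \<Phi> p q) \<in> \<real>\<^sub>\<ge>\<^sub>0"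
  shows "(\<Sum>p\<in>A. \<Sum>q\<in>A. \<Phi> p q * of_real (J (\<lambda>y. g (y \<otimes> inv (x p \<otimes> inv (x q))) * g y))) \<in> \<real>\<^sub>\<ge>\<^sub>0"
proof -
  define h where "h = (\<lambda>(p, q) y. g (y \<otimes> inv (x p)) * g (y \<otimes> inv (x q)))"
  have gt: "(\<lambda>y. g (y \<otimes> t)) \<in> Cc_nonneg" if "t \<in> carrier G" for t
    using Cc_nonneg_translate[OF g that] .
  have prod: "(\<lambda>y. u y * v y) \<in> Cc_nonneg" if "u \<in> Cc_nonneg" "v \<in> Cc_nonneg" for u v
    using that by (intro Cc_nonneg_mult Cc_nonneg_continuous Cc_nonneg_ge_0)
  have h: "h i \<in> Cc_nonneg" if "i \<in> A \<times> A" for i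
    using that x by (auto simp: h_def intro!: prod gt)
  have Jh: "J (\<lambda>y. g (y \<otimes> inv (x p \<otimes> inv (x q))) * g y) = J (h (p, q))" if "p \<in> A" "q \<in> A" for p q
  proof -
    have xs: "x p \<in> carrier G" "x q \<in> carrier G" using x that by auto
    have k: "(\<lambda>y. g (y \<otimes> inv (x p \<otimes> inv (x q))) * g y) \<in> Cc_nonneg"
      using xs by (intro prod gt g) auto
    have "J (h (p, q)) = J (\<lambda>y. g (y \<otimes> inv (x q) \<otimes> inv (x p \<otimes> inv (x q))) * g (y \<otimes> inv (x q)))"
    proof (rule haar_cong)
      show "h (p, q) \<in> Cc_nonneg" using that by (intro h) simp
      show "(\<lambda>y. g (y \<otimes> inv (x q) \<otimes> inv (x p \<otimes> inv (x q))) * g (y \<otimes> inv (x q))) \<in> Cc_nonneg"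
        using Cc_nonneg_translate[OF k inv_closed[OF xs(2)]] .
      fix y assume y: "y \<in> carrier G"
      have "y \<otimes> inv (x q) \<otimes> (x q \<otimes> inv (x p)) = y \<otimes> inv (x p)"
        using y xs by (metis inv_closed inv_solve_right m_assoc m_closed)
      then have "y \<otimes> inv (x q) \<otimes> inv (x p \<otimes> inv (x q)) = y \<otimes> inv (x p)"
        using xs by (simp add: inv_mult_group)
      then show "h (p, q) y = g (y \<otimes> inv (x q) \<otimes> inv (x p \<otimes> inv (x q))) * g (y \<otimes> inv (x q))"
        by (simp add: h_def)
    qed
    then show ?thesis using haar_translate[OF J k inv_closed[OF xs(2)]] by simp
  qed
  define S where "S = (\<Sum>p\<in>A. \<Sum>q\<in>A. \<Phi> p q * of_real (J (\<lambda>y. g (y \<otimes> inv (x p \<otimes> inv (x q))) * g y)))"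
  have S: "S = (\<Sum>i\<in>A \<times> A. \<Phi> (fst i) (snd i) * of_real (J (h i)))"
    unfolding S_def sum.cartesian_product by (intro sum.cong refl) (auto simp: Jh)
  define R where "R = (\<lambda>y. \<Sum>i\<in>A \<times> A. \<Phi> (fst i) (snd i) * of_real (h i y))"
  have R: "R y \<in> \<real>\<^sub>\<ge>\<^sub>0" for y
  proof -
    have "R y = (\<Sum>p\<in>A. \<Sum>q\<in>A. of_real (g (y \<otimes> inv (x p))) * cnj (of_real (g (y \<otimes> inv (x q)))) * \<Phi> p q)"
      unfolding R_def sum.cartesian_product by (intro sum.cong refl) (auto simp: h_def mult_ac)
    then show ?thesis using pd[of "\<lambda>p. of_real (g (y \<otimes> inv (x p)))"] by simp
  qed
  have AA: "finite (A \<times> A)" using A by simp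
  have lin: "0 \<le> (\<Sum>i\<in>A \<times> A. r i * J (h i))"
    if "\<And>y. 0 \<le> (\<Sum>i\<in>A \<times> A. r i * h i y)" for r
    by (rule haar_linear_combination_nonneg[OF AA h that])
  \<comment> \<open>\<open>J\<close> is a real functional, so
    \<open>S \<in> \<real>\<^sub>\<ge>\<^sub>0\<close> is checked through three real combinations:
    the real part, the imaginary part and its negative.\<close>
  have "0 \<le> Re S"
    unfolding S Re_sum using lin[of "\<lambda>i. Re (\<Phi> (fst i) (snd i))"] R
    by (simp add: R_def complex_nonneg_Reals_iff)
  moreover have "0 \<le> Im S"
    unfolding S Im_sum using lin[of "\<lambda>i. Im (\<Phi> (fst i) (snd i))"] R
    by (simp add: R_def complex_nonneg_Reals_iff)
  moreover have "0 \<le> - Im S"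
    unfolding S Im_sum using lin[of "\<lambda>i. - Im (\<Phi> (fst i) (snd i))"] R
    by (simp add: R_def complex_nonneg_Reals_iff sum_negf)
  ultimately have "S \<in> \<real>\<^sub>\<ge>\<^sub>0" by (simp add: complex_nonneg_Reals_iff)
  then show ?thesis by (simp add: S_def)
qed

end

text \<open>Since \<open>y \<otimes> inv x = (y \<otimes> inv a) \<otimes> (a \<otimes> inv
  x)\<close>, right uniform continuity of \<open>g\<close> bounds the change of the first factor by
  \<open>\<delta>\<close> for all \<open>y\<close> at once, once \<open>a \<otimes> inv x\<close> is
  near the unit. Multiplying by \<open>g y\<close> and applying \<open>J\<close> bounds the change
  of the autocorrelation by \<open>\<delta> * J g\<close>.\<close>

lemma haar_autocorrelation_continuous:
  assumes J: "haar_functional J" and g: "g \<in> Cc_nonneg"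
  shows "continuous_map T euclideanreal (\<lambda>x. J (\<lambda>y. g (y \<otimes> inv x) * g y))"
proof -
  let ?u = "\<lambda>x. J (\<lambda>y. g (y \<otimes> inv x) * g y)"
  have prod: "(\<lambda>y. g (y \<otimes> inv x) * g y) \<in> Cc_nonneg" if "x \<in> carrier G" for x
    using that Cc_nonneg_translate[OF g inv_closed[OF that]]
    by (intro Cc_nonneg_mult g Cc_nonneg_continuous Cc_nonneg_ge_0)
  obtain K where K: "compactin T K" "{x \<in> carrier G. g x \<noteq> 0} \<subseteq> K"
    using Cc_nonneg_support[OF g] by blast
  have "\<exists>U. openin T U \<and> a \<in> U \<and> (\<forall>x\<in>U. ?u x \<in> ball (?u a) \<epsilon>)"
    if a: "a \<in> carrier G" and e: "\<epsilon> > 0" for a \<epsilon>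
  proof -
    \<comment> \<open>The added 1 avoids division by 0 and makes
      \<open>\<delta> * J g < \<epsilon>\<close> strict.\<close>
    define \<delta> where "\<delta> = \<epsilon> / (J g + 1)"
    have Jg: "0 \<le> J g" using haar_nonneg[OF J g] .
    have \<delta>: "\<delta> > 0" "\<delta> * J g < \<epsilon>"
      using Jg e by (auto simp: \<delta>_def field_simps)
    obtain V where V: "openin T V" "\<one> \<in> V"
      "\<And>v x. v \<in> V \<Longrightarrow> x \<in> carrier G \<Longrightarrow> \<bar>g (x \<otimes> v) - g x\<bar> < \<delta>"
      using uniformly_continuous_right[OF Cc_nonneg_continuous[OF g] K \<delta>(1)] by metis
    have step: "?u x \<le> ?u x' + \<delta> * J g"
      if x: "x \<in> carrier G" "x' \<in> carrier G"
        and le: "\<And>y. y \<in> carrier G \<Longrightarrow> g (y \<otimes> inv x) \<le> g (y \<otimes> inv x') + \<delta>" for x x'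
    proof -
      have dg: "(\<lambda>y. \<delta> * g y) \<in> Cc_nonneg" using Cc_nonneg_cmult[OF g] \<delta>(1) by simp
      have "?u x \<le> J (\<lambda>y. g (y \<otimes> inv x') * g y + \<delta> * g y)"
      proof (rule haar_mono[OF J prod[OF x(1)] Cc_nonneg_add[OF prod[OF x(2)] dg]])
        fix y assume y: "y \<in> carrier G"
        show "g (y \<otimes> inv x) * g y \<le> g (y \<otimes> inv x') * g y + \<delta> * g y"
          using mult_right_mono[OF le[OF y] Cc_nonneg_ge_0[OF g y]] by (simp add: algebra_simps)
      qed
      also have "\<dots> = ?u x' + \<delta> * J g"
        using haar_add[OF J prod[OF x(2)] dg] haar_cmult[OF J g, of \<delta>] \<delta>(1) by simp
      finally show ?thesis .
    qed
    define U where "U = {x \<in> carrier G. a \<otimes> inv x \<in> V}"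
    have "continuous_map T T (\<lambda>x. a \<otimes> inv x)"
      using a by (intro continuous_map_group_mult continuous_inv) auto
    then have "openin T U"
      using openin_continuous_map_preimage[OF _ V(1)] by (fastforce simp: U_def)
    moreover have "a \<in> U" using a V(2) by (simp add: U_def)
    moreover have "?u x \<in> ball (?u a) \<epsilon>" if "x \<in> U" for x
    proof -
      have x: "x \<in> carrier G" "a \<otimes> inv x \<in> V" using that by (auto simp: U_def)
      have d: "\<bar>g (y \<otimes> inv x) - g (y \<otimes> inv a)\<bar> < \<delta>" if "y \<in> carrier G" for y
      proof -
        have "y \<otimes> inv a \<otimes> (a \<otimes> inv x) = y \<otimes> inv x"
          using that a x(1) by (metis inv_closed inv_solve_right m_assoc m_closed)
        then show ?thesis using V(3)[OF x(2), of "y \<otimes> inv a"] that a by simp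
      qed
      have d1: "g (y \<otimes> inv x) \<le> g (y \<otimes> inv a) + \<delta>"
        and d2: "g (y \<otimes> inv a) \<le> g (y \<otimes> inv x) + \<delta>" if "y \<in> carrier G" for y
        using d[OF that] by linarith+
      have "?u x \<le> ?u a + \<delta> * J g" by (rule step[OF x(1) a d1])
      moreover have "?u a \<le> ?u x + \<delta> * J g" by (rule step[OF a x(1) d2])
      ultimately have "\<bar>?u a - ?u x\<bar> < \<epsilon>" using \<delta>(2) by linarith
      then show ?thesis by (simp add: dist_real_def)
    qed
    ultimately show ?thesis by blast
  qed
  then show ?thesis
    using Met_TC.continuous_map_to_metric[of T ?u] by simp
qed

end

section \<open>Bump functions and normalised autocorrelations\<close>

context locally_compact_group
begin

text \<open>Continuity of \<open>inv x \<otimes> y\<close> at the pair of units gives a compact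
  neighbourhood \<open>K\<close> of the unit whose quotients lie in \<open>V\<close>. A locally
  compact Hausdorff space is completely regular, which supplies a function separating the unit from
  the complement of an open subset of \<open>K\<close>.\<close>

lemma bump_function_exists:
  assumes V: "openin T V" "\<one> \<in> V"
  obtains g K where "g \<in> Cc_nonneg" "g \<one> = 1" "compactin T K" "{x \<in> carrier G. g x \<noteq> 0} \<subseteq> K"
    "\<forall>x\<in>K. \<forall>y\<in>K. inv x \<otimes> y \<in> V"
proof -
  define W where "W = {p \<in> topspace (prod_topology T T). inv (fst p) \<otimes> snd p \<in> V}"
  have "continuous_map (prod_topology T T) T (\<lambda>p. inv (fst p) \<otimes> snd p)"
    by (intro continuous_map_group_mult continuous_map_inverse continuous_map_fst continuous_map_snd)
  then have "openin (prod_topology T T) W"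
    unfolding W_def using V(1) by (rule openin_continuous_map_preimage)
  moreover have "{\<one>} \<times> {\<one>} \<subseteq> W" using V(2) by (simp add: W_def)
  ultimately obtain A B where AB: "openin T A" "openin T B" "\<one> \<in> A" "\<one> \<in> B" "A \<times> B \<subseteq> W"
    using Wallace_theorem_prod_topology[of T "{\<one>}" T "{\<one>}" W] by auto
  have "neighbourhood_base_of (compactin T) T"
    using locally_compact_space_neighbourhood_base Hausdorff locally_compact by blast
  then obtain U K where UK: "openin T U" "compactin T K" "\<one> \<in> U" "U \<subseteq> K" "K \<subseteq> A \<inter> B"
    using AB unfolding neighbourhood_base_of by (metis IntI openin_Int)
  have cr: "completely_regular_space T"
    using locally_compact_regular_imp_completely_regular_space locally_compact Hausdorff by blast
  have cl: "closedin T (topspace T - U)" using UK(1) by blast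
  have pt: "\<one> \<in> topspace T - (topspace T - U)" using UK(3) by simp
  obtain f :: "'a \<Rightarrow> real" where f: "continuous_map T (top_of_set {0..1}) f" "f \<one> = 0"
    "f ` (topspace T - U) \<subseteq> {1}"
    using cr[unfolded completely_regular_space_def, rule_format, OF conjI[OF cl pt]] by blast
  have f1: "continuous_map T euclideanreal f" "\<And>x. x \<in> carrier G \<Longrightarrow> f x \<le> 1"
    using f(1) unfolding continuous_map_in_subtopology by auto
  have sup: "{x \<in> carrier G. 1 - f x \<noteq> 0} \<subseteq> K"
    using f(3) UK(4) by auto
  show thesis
  proof
    show "(\<lambda>x. 1 - f x) \<in> Cc_nonneg"
      using f1 by (intro Cc_nonnegI[OF _ _ UK(2) sup] continuous_map_diff) auto
    show "1 - f \<one> = 1" using f(2) by simp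
    show "\<forall>x\<in>K. \<forall>y\<in>K. inv x \<otimes> y \<in> V"
    proof (intro ballI)
      fix x y assume "x \<in> K" "y \<in> K"
      then have "(x, y) \<in> W" using AB(5) UK(5) by blast
      then show "inv x \<otimes> y \<in> V" by (simp add: W_def)
    qed
  qed (use UK(2) sup in auto)
qed

text \<open>\<open>w\<close> is the autocorrelation of a bump function divided by its value at the
  unit. If it is nonzero at \<open>x\<close>, some \<open>y\<close> has both \<open>y\<close> and
  \<open>y \<otimes> inv x\<close> in \<open>K\<close>, so \<open>x\<close> is a quotient of two
  points of \<open>K\<close>. In the last clause the coefficients are absorbed into
  \<open>\<Phi>\<close>; the index type is a parameter, later instantiated with pairs.\<close>

lemma schur_kernel_exists:
  assumes V: "openin T V" "\<one> \<in> V"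
  obtains w :: "'a \<Rightarrow> real" and C where "continuous_map T euclideanreal w" "w \<one> = 1"
    "compactin T C" "C \<subseteq> V" "{x \<in> carrier G. w x \<noteq> 0} \<subseteq> C"
    "\<forall>(A :: 'i set) x \<Phi>. finite A \<longrightarrow> x ` A \<subseteq> carrier G \<longrightarrow>
      (\<forall>c. (\<Sum>p\<in>A. \<Sum>q\<in>A. c p * cnj (c q) * \<Phi> p q) \<in> \<real>\<^sub>\<ge>\<^sub>0) \<longrightarrow>
      (\<Sum>p\<in>A. \<Sum>q\<in>A. \<Phi> p q * of_real (w (x p \<otimes> inv (x q)))) \<in> \<real>\<^sub>\<ge>\<^sub>0"
proof -
  obtain g K where g: "g \<in> Cc_nonneg" "g \<one> = 1" and K: "compactin T K" "{x \<in> carrier G. g x \<noteq> 0} \<subseteq> K"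
    and KV: "\<forall>x\<in>K. \<forall>y\<in>K. inv x \<otimes> y \<in> V"
    using bump_function_exists[OF V] by blast
  have "0 < g \<one>" using g(2) by simp
  then obtain J where J: "haar_functional J"
    using haar_functional_exists[OF g(1) one_closed] by blast
  define u where "u = (\<lambda>x. J (\<lambda>y. g (y \<otimes> inv x) * g y))"
  have prod: "(\<lambda>y. g (y \<otimes> inv x) * g y) \<in> Cc_nonneg" if "x \<in> carrier G" for x
    using that Cc_nonneg_translate[OF g(1) inv_closed[OF that]]
    by (intro Cc_nonneg_mult g(1) Cc_nonneg_continuous Cc_nonneg_ge_0)
  have u1: "0 < u \<one>"
    unfolding u_def by (rule haar_pos[OF J prod[OF one_closed] one_closed]) (simp add: g(2))
  define C where "C = (\<lambda>p. inv (fst p) \<otimes> snd p) ` (K \<times> K)"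
  have KG: "K \<subseteq> carrier G" using compactin_subset_topspace[OF K(1)] by simp
  show thesis
  proof
    show "continuous_map T euclideanreal (\<lambda>x. u x / u \<one>)"
      using continuous_map_real_mult_right[OF haar_autocorrelation_continuous[OF J g(1)], of "1 / u \<one>"]
      by (simp add: u_def)
    show "u \<one> / u \<one> = 1" using u1 by simp
    have "continuous_map (prod_topology T T) T (\<lambda>p. inv (fst p) \<otimes> snd p)"
      by (intro continuous_map_group_mult continuous_map_inverse continuous_map_fst continuous_map_snd)
    moreover have "compactin (prod_topology T T) (K \<times> K)" using K(1) by (simp add: compactin_Times)
    ultimately show "compactin T C" unfolding C_def by (rule image_compactin[rotated])
    show "C \<subseteq> V" using KV by (auto simp: C_def)
    show "{x \<in> carrier G. u x / u \<one> \<noteq> 0} \<subseteq> C"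
    proof
      fix x assume "x \<in> {x \<in> carrier G. u x / u \<one> \<noteq> 0}"
      then have x: "x \<in> carrier G" "u x \<noteq> 0" by auto
      have "\<exists>y\<in>carrier G. g (y \<otimes> inv x) * g y \<noteq> 0"
      proof (rule ccontr)
        assume "\<not> ?thesis"
        then have "u x = J (\<lambda>y. 0)"
          unfolding u_def by (intro haar_cong[OF J prod[OF x(1)] Cc_nonneg_zero]) simp
        then show False using x(2) haar_zero[OF J] by simp
      qed
      then obtain y where y: "y \<in> carrier G" "g (y \<otimes> inv x) \<noteq> 0" "g y \<noteq> 0" by auto
      then have "y \<otimes> inv x \<in> K" "y \<in> K" using K(2) x(1) by auto
      moreover have "x = inv (y \<otimes> inv x) \<otimes> y"
        using x(1) y(1) by (simp add: inv_mult_group m_assoc)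
      ultimately show "x \<in> C" unfolding C_def by force
    qed
    have "(\<Sum>p\<in>A. \<Sum>q\<in>A. \<Phi> p q * of_real (u (x p \<otimes> inv (x q)) / u \<one>)) \<in> \<real>\<^sub>\<ge>\<^sub>0"
      if A: "finite A" "x ` A \<subseteq> carrier G"
        and pd: "\<And>c. (\<Sum>p\<in>A. \<Sum>q\<in>A. c p * cnj (c q) * \<Phi> p q) \<in> \<real>\<^sub>\<ge>\<^sub>0"
      for A :: "'i set" and x and \<Phi> :: "'i \<Rightarrow> 'i \<Rightarrow> complex"
    proof -
      have "(\<Sum>p\<in>A. \<Sum>q\<in>A. \<Phi> p q * of_real (u (x p \<otimes> inv (x q)))) \<in> \<real>\<^sub>\<ge>\<^sub>0"
        unfolding u_def using A(2) by (intro haar_autocorrelation_schur[OF J g(1) A(1) _ pd]) auto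
      then have "of_real (1 / u \<one>) * (\<Sum>p\<in>A. \<Sum>q\<in>A. \<Phi> p q * of_real (u (x p \<otimes> inv (x q)))) \<in> \<real>\<^sub>\<ge>\<^sub>0"
        using u1 by (intro nonneg_Reals_mult_I) auto
      then show ?thesis by (simp add: sum_distrib_left mult_ac divide_inverse)
    qed
    then show "\<forall>(A :: 'i set) x \<Phi>. finite A \<longrightarrow> x ` A \<subseteq> carrier G \<longrightarrow>
      (\<forall>c. (\<Sum>p\<in>A. \<Sum>q\<in>A. c p * cnj (c q) * \<Phi> p q) \<in> \<real>\<^sub>\<ge>\<^sub>0) \<longrightarrow>
      (\<Sum>p\<in>A. \<Sum>q\<in>A. \<Phi> p q * of_real (u (x p \<otimes> inv (x q)) / u \<one>)) \<in> \<real>\<^sub>\<ge>\<^sub>0"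
      by blast
  qed
qed

end

subsection \<open>Extension from the cyclic subgroup\<close>

text \<open>The instance of positive definiteness in which the points run once through all residues.
  The shift \<open>int j - 1\<close> matches the indices from 1 to \<open>m\<close> with the
  residues from 0 to \<open>m - 1\<close>.\<close>

lemma positive_definite_cyclic:
  assumes pd: "positive_definite (integer_mod_group m) \<phi>" and m: "0 < m"
  shows "(\<Sum>a\<in>{0..<int m}. \<Sum>b\<in>{0..<int m}. e a * cnj (e b) * \<phi> ((a - b) mod int m)) \<in> \<real>\<^sub>\<ge>\<^sub>0"
proof -
  define h where "h = (\<lambda>j::nat. int j - 1)"
  have h: "bij_betw h {1..m} {0..<int m}"
    unfolding h_def
    by (rule bij_betwI[where g = "\<lambda>a. nat (a + 1)"]) auto
  have hc: "h j \<in> carrier (integer_mod_group m)" if "j \<in> {1..m}" for j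
    using that m by (auto simp: h_def carrier_integer_mod_group)
  have "(\<Sum>j=1..m. \<Sum>k=1..m. e (h j) * cnj (e (h k)) *
      \<phi> (h j \<otimes>\<^bsub>integer_mod_group m\<^esub> inv\<^bsub>integer_mod_group m\<^esub> (h k))) \<in> \<real>\<^sub>\<ge>\<^sub>0"
    using pd[unfolded positive_definite_def, rule_format, of m h "\<lambda>j. e (h j)"] hc by simp
  also have "(\<Sum>j=1..m. \<Sum>k=1..m. e (h j) * cnj (e (h k)) *
      \<phi> (h j \<otimes>\<^bsub>integer_mod_group m\<^esub> inv\<^bsub>integer_mod_group m\<^esub> (h k)))
    = (\<Sum>j=1..m. \<Sum>k=1..m. e (h j) * cnj (e (h k)) * \<phi> ((h j - h k) mod int m))"
    using hc by (intro sum.cong refl) (simp add: mod_add_right_eq)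
  also have "\<dots> = (\<Sum>a\<in>{0..<int m}. \<Sum>b\<in>{0..<int m}. e a * cnj (e b) * \<phi> ((a - b) mod int m))"
    by (subst sum.reindex_bij_betw[OF h, symmetric], intro sum.cong refl,
        subst sum.reindex_bij_betw[OF h, symmetric], rule refl)
  finally show ?thesis .
qed

text \<open>As \<open>z\<close> has order \<open>m\<close>, taking powers of \<open>z\<close> is a
  homomorphism from the integers mod \<open>m\<close>, and positive definiteness pulls back along
  homomorphisms.\<close>

lemma positive_definite_restrict_powers:
  fixes G (structure)
  assumes "group G" and z: "z \<in> carrier G" and f: "positive_definite G f" and m: "group.ord G z = m" "0 < m"
  shows "positive_definite (integer_mod_group m) (\<lambda>k. f (z [^] k))"
  unfolding positive_definite_def
proof (intro allI impI)
  interpret group G by fact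
  fix n :: nat and x :: "nat \<Rightarrow> int" and c :: "nat \<Rightarrow> complex"
  assume x: "\<forall>j\<in>{1..n}. x j \<in> carrier (integer_mod_group m)"
  have eq: "z [^] (x j \<otimes>\<^bsub>integer_mod_group m\<^esub> inv\<^bsub>integer_mod_group m\<^esub> (x k)) = z [^] x j \<otimes> inv (z [^] x k)"
    if "j \<in> {1..n}" "k \<in> {1..n}" for j k
  proof -
    have "x j \<otimes>\<^bsub>integer_mod_group m\<^esub> inv\<^bsub>integer_mod_group m\<^esub> (x k) = (x j - x k) mod int m"
      using x that by (simp add: mod_add_right_eq)
    moreover have "z [^] ((x j - x k) mod int m) = z [^] (x j - x k)"
      unfolding int_pow_eq[OF z] m(1) by (simp add: mod_eq_dvd_iff[symmetric])
    ultimately show ?thesis using z by (simp add: int_pow_diff)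
  qed
  have "(\<Sum>j=1..n. \<Sum>k=1..n. c j * cnj (c k) * f (z [^] x j \<otimes> inv (z [^] x k))) \<in> \<real>\<^sub>\<ge>\<^sub>0"
    using f[unfolded positive_definite_def, rule_format, of n "\<lambda>j. z [^] x j" c] z by simp
  also have "(\<Sum>j=1..n. \<Sum>k=1..n. c j * cnj (c k) * f (z [^] x j \<otimes> inv (z [^] x k)))
    = (\<Sum>j=1..n. \<Sum>k=1..n. c j * cnj (c k) * f (z [^] (x j \<otimes>\<^bsub>integer_mod_group m\<^esub> inv\<^bsub>integer_mod_group m\<^esub> (x k))))"
    by (intro sum.cong refl) (simp only: eq)
  finally show "\<dots> \<in> \<real>\<^sub>\<ge>\<^sub>0" .
qed

section \<open>Continuous extension of a positive definite function on the powers of an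
  element\<close>

context locally_compact_group
begin

lemma F_cont_subset_F_sharp: "F_cont G T \<Omega> \<subseteq> F_sharp G \<Omega>"
proof
  fix f assume f: "f \<in> F_cont G T \<Omega>"
  have "f x = 0" if x: "x \<in> carrier G - \<Omega>" for x
  proof (rule ccontr)
    assume "f x \<noteq> 0"
    then have "x \<in> closed_support T f"
      unfolding closed_support_def using x by (intro subsetD[OF closure_of_subset]) auto
    then show False using f x by (auto simp: F_cont_def)
  qed
  then show "f \<in> F_sharp G \<Omega>" using f by (simp add: F_cont_def F_sharp_def)
qed

lemma extend_from_cyclic:
  assumes \<Omega>: "openin T \<Omega>" and z: "z \<in> carrier G" "ord z = m" "0 < m"
    and pd: "positive_definite (integer_mod_group m) \<phi>" and \<phi>0: "\<phi> 0 = 1"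
    and sup: "\<forall>k\<in>{0..<int m}. z [^] k \<notin> \<Omega> \<longrightarrow> \<phi> k = 0"
  obtains f where "f \<in> F_cont G T \<Omega>" "\<forall>k::int. f (z [^] k) = \<phi> (k mod int m)"
    "real_valued_on (carrier (integer_mod_group m)) \<phi> \<longrightarrow> real_valued_on (carrier G) f"
proof -
  define M where "M = {0..<int m}"
  have finM: "finite M" by (simp add: M_def)
  have zc: "z [^] k \<in> carrier G" for k :: int using z(1) by simp
  have zmod: "z [^] (k mod int m) = z [^] k" for k :: int
    unfolding int_pow_eq[OF z(1)] z(2) by (simp add: mod_eq_dvd_iff[symmetric])
  have modM: "k mod int m \<in> M" for k using z(3) by (simp add: M_def)
  \<comment> \<open>The pairs \<open>(a, b)\<close> that contribute to the double sum defining
    \<open>f\<close>. There are finitely many, and \<open>z [^] (a - b)\<close> lies in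
    \<open>\<Omega>\<close> for each of them.\<close>
  define P where "P = {(a, b) \<in> M \<times> M. \<phi> ((a - b) mod int m) \<noteq> 0}"
  have finP: "finite P" unfolding P_def by (rule finite_subset[of _ "M \<times> M"]) (auto simp: finM)
  have Pz: "z [^] (a - b) \<in> \<Omega>" if "(a, b) \<in> P" for a b
    using sup[rule_format, of "(a - b) mod int m"] that modM[of "a - b"] by (auto simp: P_def M_def zmod)
  \<comment> \<open>Two demands on the support of \<open>w\<close>: its translates by
    \<open>z [^] a\<close> and \<open>z [^] (- b)\<close> with \<open>(a, b)\<close> in
    \<open>P\<close> stay inside \<open>\<Omega>\<close>, and it avoids the powers of
    \<open>z\<close> other than the unit. The removed set is finite, hence closed.\<close>
  define V where "V = ((\<Inter>p\<in>P. {x \<in> carrier G. z [^] fst p \<otimes> x \<otimes> z [^] (- snd p) \<in> \<Omega>}) \<inter> topspace T)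
    - (\<lambda>k. z [^] k) ` {1..<int m}"
  have fin: "finite ((\<lambda>k. z [^] k) ` {1..<int m})" by simp
  have "closedin T ((\<lambda>k. z [^] k) ` {1..<int m})"
    using closedin_Hausdorff_finite[OF Hausdorff _ fin] zc by auto
  moreover have "openin T ((\<Inter>p\<in>P. {x \<in> carrier G. z [^] fst p \<otimes> x \<otimes> z [^] (- snd p) \<in> \<Omega>}) \<inter> topspace T)"
    by (intro openin_INT finP openin_translate \<Omega> zc)
  ultimately have V: "openin T V" unfolding V_def by blast
  have V1: "\<one> \<in> V"
  proof -
    have "z [^] k \<noteq> \<one>" if "k \<in> {1..<int m}" for k
      using that int_pow_eq_id[OF z(1), of k] z(2) zdvd_not_zless[of k "int m"] by auto
    moreover have "z [^] a \<otimes> \<one> \<otimes> z [^] (- b) \<in> \<Omega>" if "(a, b) \<in> P" for a b :: int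
      using Pz[OF that] z(1) by (simp add: int_pow_diff int_pow_neg)
    ultimately show ?thesis unfolding V_def by fastforce
  qed
  obtain w C where w: "continuous_map T euclideanreal w" "w \<one> = 1"
    and C: "compactin T C" "C \<subseteq> V" "{x \<in> carrier G. w x \<noteq> 0} \<subseteq> C"
    and wpd: "\<forall>(A :: (nat \<times> int) set) x \<Phi>. finite A \<longrightarrow> x ` A \<subseteq> carrier G \<longrightarrow>
      (\<forall>c. (\<Sum>p\<in>A. \<Sum>q\<in>A. c p * cnj (c q) * \<Phi> p q) \<in> \<real>\<^sub>\<ge>\<^sub>0) \<longrightarrow>
      (\<Sum>p\<in>A. \<Sum>q\<in>A. \<Phi> p q * of_real (w (x p \<otimes> inv (x q)))) \<in> \<real>\<^sub>\<ge>\<^sub>0"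
    by (rule schur_kernel_exists[OF V V1])
  \<comment> \<open>On the powers of \<open>z\<close> the function \<open>w\<close> acts as a
    Kronecker delta at the unit, by the second demand on \<open>V\<close>.\<close>
  have wz: "w (z [^] k) = (if int m dvd k then 1 else 0)" for k :: int
  proof (cases "int m dvd k")
    case True
    then show ?thesis using int_pow_eq_id[OF z(1), of k] z(2) w(2) by simp
  next
    case False
    then have "k mod int m \<noteq> 0" by (simp add: dvd_eq_mod_eq_0)
    moreover have "k mod int m \<in> M" by (rule modM)
    ultimately have "k mod int m \<in> {1..<int m}" by (simp add: M_def)
    then have "z [^] (k mod int m) \<in> (\<lambda>k. z [^] k) ` {1..<int m}" by blast
    then have "z [^] k \<notin> V" by (simp add: V_def zmod)
    then have "w (z [^] k) = 0" using C zc[of k] by blast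
    then show ?thesis using False by simp
  qed
  define f where "f = (\<lambda>x. of_real (1 / m) * (\<Sum>a\<in>M. \<Sum>b\<in>M. \<phi> ((a - b) mod int m) *
    of_real (w (z [^] (- a) \<otimes> x \<otimes> z [^] b))) :: complex)"
  have fz: "f (z [^] k) = \<phi> (k mod int m)" for k :: int
  proof -
    \<comment> \<open>For fixed \<open>b\<close> only the residue \<open>a\<close> of
      \<open>k + b\<close> survives, and there \<open>a - b\<close> is congruent to
      \<open>k\<close>. Each of the \<open>m\<close> values of \<open>b\<close> thus gives
      \<open>\<phi> (k mod int m)\<close> once, which the factor \<open>1 / m\<close> in
      \<open>f\<close> compensates.\<close>
    have "(\<Sum>a\<in>M. \<phi> ((a - b) mod int m) * of_real (w (z [^] (- a) \<otimes> z [^] k \<otimes> z [^] b))) = \<phi> (k mod int m)"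
      if b: "b \<in> M" for b
    proof -
      have "(\<Sum>a\<in>M. \<phi> ((a - b) mod int m) * of_real (w (z [^] (- a) \<otimes> z [^] k \<otimes> z [^] b)))
        = (\<Sum>a\<in>M. if (k + b) mod int m = a then \<phi> (k mod int m) else 0)"
      proof (rule sum.cong[OF refl])
        fix a assume a: "a \<in> M"
        have "z [^] (- a) \<otimes> z [^] k \<otimes> z [^] b = z [^] (k + b - a)"
          using z(1) by (simp add: int_pow_mult[symmetric] algebra_simps)
        moreover have iff: "int m dvd (k + b - a) \<longleftrightarrow> (k + b) mod int m = a"
          using a by (simp add: mod_eq_dvd_iff[symmetric] M_def)
        moreover have "(a - b) mod int m = k mod int m" if "int m dvd (k + b - a)"
          using that by (metis mod_eq_dvd_iff diff_diff_eq2 diff_add_eq)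
        ultimately show "\<phi> ((a - b) mod int m) * of_real (w (z [^] (- a) \<otimes> z [^] k \<otimes> z [^] b))
          = (if (k + b) mod int m = a then \<phi> (k mod int m) else 0)"
          by (simp add: wz)
      qed
      also have "\<dots> = \<phi> (k mod int m)" using modM[of "k + b"] finM by simp
      finally show ?thesis .
    qed
    then have "f (z [^] k) = of_real (1 / m) * (\<Sum>b\<in>M. \<phi> (k mod int m))"
      unfolding f_def by (subst sum.swap) simp
    then show ?thesis using z(3) by (simp add: M_def)
  qed
  have "positive_definite G f"
    unfolding positive_definite_def
  proof (intro allI impI)
    fix n :: nat and x :: "nat \<Rightarrow> 'a" and c :: "nat \<Rightarrow> complex"
    assume x: "\<forall>j\<in>{1..n}. x j \<in> carrier G"
    \<comment> \<open>The Schur property is applied to the enlarged family of points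
      \<open>z [^] (- a) \<otimes> x j\<close>, indexed by pairs, with a matrix
      \<open>\<Phi>\<close> that carries the coefficients \<open>c\<close>. The resulting sum is
      \<open>m\<close> times the quadratic form of \<open>f\<close>.\<close>
    define A where "A = {1..n} \<times> M"
    define y where "y = (\<lambda>(j::nat, a::int). z [^] (- a) \<otimes> x j)"
    define \<Phi> where "\<Phi> = (\<lambda>(j, a) (k, b). c j * cnj (c k) * \<phi> ((a - b) mod int m))"
    have A: "finite A" "y ` A \<subseteq> carrier G" using finM x zc by (auto simp: A_def y_def)
    have "(\<Sum>p\<in>A. \<Sum>q\<in>A. d p * cnj (d q) * \<Phi> p q) \<in> \<real>\<^sub>\<ge>\<^sub>0" for d
    proof -
      \<comment> \<open>Collecting the coefficients over \<open>j\<close> reduces the form of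
        \<open>\<Phi>\<close> on pairs to the form of \<open>\<phi>\<close> on residues.\<close>
      define e where "e = (\<lambda>a. \<Sum>j=1..n. d (j, a) * c j)"
      have "(\<Sum>p\<in>A. \<Sum>q\<in>A. d p * cnj (d q) * \<Phi> p q)
        = (\<Sum>j=1..n. \<Sum>a\<in>M. \<Sum>k=1..n. \<Sum>b\<in>M.
            (d (j, a) * c j) * cnj (d (k, b) * c k) * \<phi> ((a - b) mod int m))"
        unfolding A_def sum.cartesian_product' \<Phi>_def by (simp add: mult_ac)
      also have "\<dots> = (\<Sum>a\<in>M. \<Sum>j=1..n. \<Sum>b\<in>M. \<Sum>k=1..n.
            (d (j, a) * c j) * cnj (d (k, b) * c k) * \<phi> ((a - b) mod int m))"
        by (subst sum.swap, intro sum.cong refl, subst sum.swap, rule refl)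
      also have "\<dots> = (\<Sum>a\<in>M. \<Sum>b\<in>M. \<Sum>j=1..n. \<Sum>k=1..n.
            (d (j, a) * c j) * cnj (d (k, b) * c k) * \<phi> ((a - b) mod int m))"
        by (intro sum.cong refl, subst sum.swap, rule refl)
      also have "\<dots> = (\<Sum>a\<in>M. \<Sum>b\<in>M. e a * cnj (e b) * \<phi> ((a - b) mod int m))"
        unfolding e_def cnj_sum sum_product unfolding sum_distrib_right ..
      finally show ?thesis using positive_definite_cyclic[OF pd z(3), of e] by (simp add: M_def)
    qed
    then have "(\<Sum>p\<in>A. \<Sum>q\<in>A. \<Phi> p q * of_real (w (y p \<otimes> inv (y q)))) \<in> \<real>\<^sub>\<ge>\<^sub>0"
      using wpd A by blast
    also have "(\<Sum>p\<in>A. \<Sum>q\<in>A. \<Phi> p q * of_real (w (y p \<otimes> inv (y q))))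
      = (\<Sum>j=1..n. \<Sum>a\<in>M. \<Sum>k=1..n. \<Sum>b\<in>M. c j * cnj (c k) * \<phi> ((a - b) mod int m) *
          of_real (w (z [^] (- a) \<otimes> x j \<otimes> inv (z [^] (- b) \<otimes> x k))))"
      unfolding A_def sum.cartesian_product' \<Phi>_def y_def by simp
    also have "\<dots> = (\<Sum>j=1..n. \<Sum>k=1..n. \<Sum>a\<in>M. \<Sum>b\<in>M. c j * cnj (c k) * \<phi> ((a - b) mod int m) *
          of_real (w (z [^] (- a) \<otimes> x j \<otimes> inv (z [^] (- b) \<otimes> x k))))"
      by (intro sum.cong refl, subst sum.swap, rule refl)
    also have "\<dots> = of_nat m * (\<Sum>j=1..n. \<Sum>k=1..n. c j * cnj (c k) * f (x j \<otimes> inv (x k)))"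
    proof -
      have "(\<Sum>a\<in>M. \<Sum>b\<in>M. c j * cnj (c k) * \<phi> ((a - b) mod int m) *
          of_real (w (z [^] (- a) \<otimes> x j \<otimes> inv (z [^] (- b) \<otimes> x k))))
        = of_nat m * (c j * cnj (c k) * f (x j \<otimes> inv (x k)))"
        if jk: "j \<in> {1..n}" "k \<in> {1..n}" for j k
      proof -
        have xx: "x j \<in> carrier G" "x k \<in> carrier G" using x jk by auto
        have "z [^] (- a) \<otimes> x j \<otimes> inv (z [^] (- b) \<otimes> x k) = z [^] (- a) \<otimes> (x j \<otimes> inv (x k)) \<otimes> z [^] b"
          for a b :: int
          using xx z(1) by (simp add: inv_mult_group int_pow_neg m_assoc)
        then show ?thesis
          using z(3) by (simp add: f_def sum_distrib_left mult_ac)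
      qed
      then show ?thesis unfolding sum_distrib_left by (intro sum.cong refl) auto
    qed
    finally have "of_nat m * (\<Sum>j=1..n. \<Sum>k=1..n. c j * cnj (c k) * f (x j \<otimes> inv (x k))) \<in> \<real>\<^sub>\<ge>\<^sub>0" .
    moreover have "complex_of_real (1 / m) \<in> \<real>\<^sub>\<ge>\<^sub>0" by simp
    ultimately have "complex_of_real (1 / m) *
        (of_nat m * (\<Sum>j=1..n. \<Sum>k=1..n. c j * cnj (c k) * f (x j \<otimes> inv (x k)))) \<in> \<real>\<^sub>\<ge>\<^sub>0"
      by (rule nonneg_Reals_mult_I[rotated])
    then show "(\<Sum>j=1..n. \<Sum>k=1..n. c j * cnj (c k) * f (x j \<otimes> inv (x k))) \<in> \<real>\<^sub>\<ge>\<^sub>0"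
      using z(3) by simp
  qed
  moreover have "f \<one> = 1" using fz[of 0] \<phi>0 by simp
  moreover have "continuous_map T euclidean f"
  proof -
    have "continuous_map T euclidean (\<lambda>x. t * of_real (w (z [^] (- a) \<otimes> x \<otimes> z [^] b)) :: complex)"
      for t :: complex and a b :: int
    proof -
      have "continuous_map T euclideanreal (\<lambda>x. w (z [^] (- a) \<otimes> x \<otimes> z [^] b))"
        using continuous_map_compose[OF continuous_map_translate[OF zc zc] w(1)] by (simp add: o_def)
      moreover have "continuous_map euclideanreal euclidean (\<lambda>r. t * of_real r :: complex)"
        by (simp add: continuous_map_iff_continuous2 continuous_intros)
      ultimately show ?thesis
        using continuous_map_compose[of T euclideanreal _ euclidean "\<lambda>r. t * of_real r"] by (force simp: o_def)
    qed
    then show ?thesis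
      unfolding f_def sum_distrib_left mult.assoc[symmetric] by (intro continuous_map_sum finM) 
  qed
  moreover have "compactin T (closed_support T f) \<and> closed_support T f \<subseteq> \<Omega>"
  proof -
    \<comment> \<open>A finite union of compact translates of \<open>C\<close>, contained in
      \<open>\<Omega>\<close> by the choice of \<open>V\<close>. In a Hausdorff space it is closed,
      so it contains the closure of the set where \<open>f\<close> is nonzero.\<close>
    define D where "D = \<Union>((\<lambda>p. (\<lambda>x. z [^] fst p \<otimes> x \<otimes> z [^] (- snd p)) ` C) ` P)"
    have D: "compactin T D"
      unfolding D_def using finP image_compactin[OF C(1) continuous_map_translate[OF zc zc]]
      by (intro compactin_Union) auto
    have D\<Omega>: "D \<subseteq> \<Omega>" using C(2) unfolding D_def V_def by auto
    have "{x \<in> topspace T. f x \<noteq> 0} \<subseteq> D"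
    proof
      fix x assume "x \<in> {x \<in> topspace T. f x \<noteq> 0}"
      then have x: "x \<in> carrier G" "f x \<noteq> 0" by auto
      have "\<exists>a\<in>M. \<exists>b\<in>M. \<phi> ((a - b) mod int m) \<noteq> 0 \<and> w (z [^] (- a) \<otimes> x \<otimes> z [^] b) \<noteq> 0"
      proof (rule ccontr)
        assume "\<not> ?thesis"
        then have "(\<Sum>a\<in>M. \<Sum>b\<in>M. \<phi> ((a - b) mod int m) * complex_of_real (w (z [^] (- a) \<otimes> x \<otimes> z [^] b))) = 0"
          by (intro sum.neutral ballI) auto
        then show False using x(2) by (simp add: f_def)
      qed
      then obtain a b where ab: "a \<in> M" "b \<in> M" "\<phi> ((a - b) mod int m) \<noteq> 0" "w (z [^] (- a) \<otimes> x \<otimes> z [^] b) \<noteq> 0"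
        by blast
      then have "(a, b) \<in> P" by (simp add: P_def)
      moreover have "z [^] (- a) \<otimes> x \<otimes> z [^] b \<in> C" using C(3) ab(4) x(1) zc by auto
      moreover have "x = z [^] a \<otimes> (z [^] (- a) \<otimes> x \<otimes> z [^] b) \<otimes> z [^] (- b)"
      proof -
        have "z [^] a \<otimes> (z [^] (- a) \<otimes> x \<otimes> z [^] b) \<otimes> z [^] (- b)
          = (z [^] a \<otimes> z [^] (- a)) \<otimes> x \<otimes> (z [^] b \<otimes> z [^] (- b))"
          using x(1) zc by (simp add: m_assoc)
        then show ?thesis using x(1) z(1) by (simp add: int_pow_mult[symmetric])
      qed
      ultimately show "x \<in> D" unfolding D_def by force
    qed
    then have sub: "closed_support T f \<subseteq> D"
      unfolding closed_support_def using compactin_imp_closedin[OF Hausdorff D] by (rule closure_of_minimal)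
    have "closedin T (closed_support T f)" unfolding closed_support_def by simp
    then show ?thesis using closed_compactin[OF D sub] sub D\<Omega> by blast
  qed
  ultimately have fF: "f \<in> F_cont G T \<Omega>" by (simp add: F_cont_def)
  have "real_valued_on (carrier G) f" if "real_valued_on (carrier (integer_mod_group m)) \<phi>"
  proof -
    have "\<phi> (k mod int m) \<in> \<real>" for k
      using that modM[of k] z(3) by (simp add: real_valued_on_def carrier_integer_mod_group M_def)
    then show ?thesis unfolding real_valued_on_def f_def
      by (intro ballI Reals_mult sum_in_Reals) auto
  qed
  then show thesis using that fF fz by blast
qed

end

section \<open>Equality of the extremal constants\<close>

theorem theorem10:
  fixes G :: "('a, 'b) monoid_scheme" and T :: "'a topology"
    and \<Omega> :: "'a set" and z :: 'a and m N :: nat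
  assumes "locally_compact_group G T"
    and "openin T \<Omega>"
    and "\<one>\<^bsub>G\<^esub> \<in> \<Omega>"
    and "(\<lambda>x. inv\<^bsub>G\<^esub> x) ` \<Omega> = \<Omega>"
    and "z \<in> \<Omega>"
    and "group.ord G z = m"
    and "0 < m"
    and "N \<le> m"
    and "{z [^]\<^bsub>G\<^esub> n | n :: int. True} \<inter> \<Omega> = {z [^]\<^bsub>G\<^esub> n | n :: int. - int N \<le> n \<and> n \<le> int N}"
  shows "C_cont G T \<Omega> z = C_sharp G \<Omega> z \<and>
         C_sharp G \<Omega> z = C_cyclic m (residue_interval m N) \<and>
         K_cont G T \<Omega> z = K_sharp G \<Omega> z \<and>
         K_sharp G \<Omega> z = K_cyclic m (residue_interval m N)"
proof -
  interpret locally_compact_group G T by fact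
  let ?Z = "integer_mod_group m" and ?H = "residue_interval m N"
  have z: "z \<in> carrier G" using openin_subset[OF assms(2)] assms(5) by auto
  have zmod: "z [^]\<^bsub>G\<^esub> (k mod int m) = z [^]\<^bsub>G\<^esub> k" for k :: int
    unfolding int_pow_eq[OF z] assms(6) by (simp add: mod_eq_dvd_iff[symmetric])
  have H: "k \<in> ?H \<longleftrightarrow> z [^]\<^bsub>G\<^esub> k \<in> \<Omega>" if k: "k \<in> {0..<int m}" for k
  proof
    assume "k \<in> ?H"
    then obtain n where n: "k = n mod int m" "- int N \<le> n" "n \<le> int N"
      by (auto simp: residue_interval_def)
    then have "z [^]\<^bsub>G\<^esub> k \<in> {z [^]\<^bsub>G\<^esub> n | n :: int. - int N \<le> n \<and> n \<le> int N}"
      using zmod by blast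
    then show "z [^]\<^bsub>G\<^esub> k \<in> \<Omega>" using assms(9) by blast
  next
    assume "z [^]\<^bsub>G\<^esub> k \<in> \<Omega>"
    then have "z [^]\<^bsub>G\<^esub> k \<in> {z [^]\<^bsub>G\<^esub> n | n :: int. True} \<inter> \<Omega>" by blast
    then obtain n :: int where n: "z [^]\<^bsub>G\<^esub> k = z [^]\<^bsub>G\<^esub> n" "- int N \<le> n" "n \<le> int N"
      unfolding assms(9) by blast
    then have "n mod int m = k mod int m"
      unfolding int_pow_eq[OF z] assms(6) by (simp add: mod_eq_dvd_iff)
    then have "k = n mod int m" using k by simp
    then show "k \<in> ?H" using n by (auto simp: residue_interval_def)
  qed
  have cZ: "carrier ?Z = {0..<int m}" using assms(7) by (simp add: carrier_integer_mod_group)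
  let ?cyc = "\<lambda>\<phi>. positive_definite ?Z \<phi> \<and> \<phi> 0 = 1 \<and> (\<forall>k\<in>carrier ?Z - ?H. \<phi> k = 0)"
  have down: "?cyc (\<lambda>k. f (z [^]\<^bsub>G\<^esub> k))" "cmod (f z) = cmod (f (z [^]\<^bsub>G\<^esub> (1 mod int m)))"
    "real_valued_on (carrier G) f \<longrightarrow> real_valued_on (carrier ?Z) (\<lambda>k. f (z [^]\<^bsub>G\<^esub> k))"
    if f: "f \<in> F_sharp G \<Omega>" for f
  proof -
    have "f (z [^]\<^bsub>G\<^esub> k) = 0" if "k \<in> carrier ?Z - ?H" for k
      using f H[of k] that z cZ by (auto simp: F_sharp_def)
    then show "?cyc (\<lambda>k. f (z [^]\<^bsub>G\<^esub> k))"
      using f positive_definite_restrict_powers[OF is_group z _ assms(6,7)] by (auto simp: F_sharp_def)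
    \<comment> \<open>Writing \<open>z\<close> as the power with exponent \<open>1 mod int m\<close>
      covers \<open>m = 1\<close> too, where \<open>z\<close> is the unit and the exponent is
      0.\<close>
    show "cmod (f z) = cmod (f (z [^]\<^bsub>G\<^esub> (1 mod int m)))" using z by (simp add: zmod)
    show "real_valued_on (carrier G) f \<longrightarrow> real_valued_on (carrier ?Z) (\<lambda>k. f (z [^]\<^bsub>G\<^esub> k))"
      using z by (simp add: real_valued_on_def)
  qed
  have up: "\<exists>f\<in>F_cont G T \<Omega>. cmod (f z) = cmod (\<phi> (1 mod int m)) \<and>
      (real_valued_on (carrier ?Z) \<phi> \<longrightarrow> real_valued_on (carrier G) f)" if \<phi>: "?cyc \<phi>" for \<phi>
  proof -
    have sup: "\<forall>k\<in>{0..<int m}. z [^]\<^bsub>G\<^esub> k \<notin> \<Omega> \<longrightarrow> \<phi> k = 0"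
      using \<phi> H cZ by blast
    obtain f where f: "f \<in> F_cont G T \<Omega>" "\<forall>k::int. f (z [^]\<^bsub>G\<^esub> k) = \<phi> (k mod int m)"
      "real_valued_on (carrier ?Z) \<phi> \<longrightarrow> real_valued_on (carrier G) f"
      using extend_from_cyclic[OF assms(2) z assms(6,7) _ _ sup] \<phi> by blast
    have "f z = \<phi> (1 mod int m)" using f(2)[rule_format, of 1] z by simp
    then show ?thesis using f(1,3) by (intro bexI[of _ f] conjI) simp_all
  qed
  \<comment> \<open>The value sets are compared instead of their suprema: continuous functions give
    a subset of the values of \<open>F_sharp\<close>, restriction puts these into \<open>Sc\<close>,
    and extension returns from \<open>Sc\<close> to continuous functions. The circle of inclusions
    makes all three sets equal, and likewise for the real-valued classes and
    \<open>Kc\<close>.\<close>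
  define Sc where "Sc = {cmod (\<phi> (1 mod int m)) |\<phi>. ?cyc \<phi>}"
  define Kc where "Kc = {cmod (\<phi> (1 mod int m)) |\<phi>. ?cyc \<phi> \<and> real_valued_on (carrier ?Z) \<phi>}"
  have incl: "F_cont G T \<Omega> \<subseteq> F_sharp G \<Omega>" by (rule F_cont_subset_F_sharp)
  have C1: "(\<lambda>f. cmod (f z)) ` F_cont G T \<Omega> \<subseteq> (\<lambda>f. cmod (f z)) ` F_sharp G \<Omega>"
    using incl by blast
  have C2: "(\<lambda>f. cmod (f z)) ` F_sharp G \<Omega> \<subseteq> Sc"
  proof (rule image_subsetI)
    fix f assume f: "f \<in> F_sharp G \<Omega>"
    show "cmod (f z) \<in> Sc"
      unfolding Sc_def mem_Collect_eq
      using down(1,2)[OF f] by (intro exI[of _ "\<lambda>k. f (z [^]\<^bsub>G\<^esub> k)"] conjI) auto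
  qed
  have C3: "Sc \<subseteq> (\<lambda>f. cmod (f z)) ` F_cont G T \<Omega>"
  proof
    fix r assume "r \<in> Sc"
    then obtain \<phi> where \<phi>: "r = cmod (\<phi> (1 mod int m))" "?cyc \<phi>" unfolding Sc_def by blast
    obtain f where "f \<in> F_cont G T \<Omega>" "cmod (f z) = r" using up[OF \<phi>(2)] \<phi>(1) by auto
    then show "r \<in> (\<lambda>f. cmod (f z)) ` F_cont G T \<Omega>" by blast
  qed
  have K1: "(\<lambda>f. cmod (f z)) ` F_cont_real G T \<Omega> \<subseteq> (\<lambda>f. cmod (f z)) ` F_sharp_real G \<Omega>"
    using incl unfolding F_cont_real_def F_sharp_real_def by blast
  have K2: "(\<lambda>f. cmod (f z)) ` F_sharp_real G \<Omega> \<subseteq> Kc"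
  proof (rule image_subsetI)
    fix f assume "f \<in> F_sharp_real G \<Omega>"
    then have f: "f \<in> F_sharp G \<Omega>" "real_valued_on (carrier G) f" by (auto simp: F_sharp_real_def)
    show "cmod (f z) \<in> Kc"
      unfolding Kc_def mem_Collect_eq
      using down[OF f(1)] f(2) by (intro exI[of _ "\<lambda>k. f (z [^]\<^bsub>G\<^esub> k)"] conjI) auto
  qed
  have K3: "Kc \<subseteq> (\<lambda>f. cmod (f z)) ` F_cont_real G T \<Omega>"
  proof
    fix r assume "r \<in> Kc"
    then obtain \<phi> where \<phi>: "r = cmod (\<phi> (1 mod int m))" "?cyc \<phi>" "real_valued_on (carrier ?Z) \<phi>"
      unfolding Kc_def by blast
    obtain f where "f \<in> F_cont G T \<Omega>" "cmod (f z) = r" "real_valued_on (carrier G) f"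
      using up[OF \<phi>(2)] \<phi>(1,3) by auto
    then show "r \<in> (\<lambda>f. cmod (f z)) ` F_cont_real G T \<Omega>" unfolding F_cont_real_def by blast
  qed
  have "C_cyclic m ?H = Sup Sc" by (simp add: C_cyclic_def Sc_def)
  moreover have "K_cyclic m ?H = Sup Kc" by (simp add: K_cyclic_def Kc_def conj_assoc)
  moreover have "(\<lambda>f. cmod (f z)) ` F_cont G T \<Omega> = Sc" "(\<lambda>f. cmod (f z)) ` F_sharp G \<Omega> = Sc"
    using C1 C2 C3 by blast+
  moreover have "(\<lambda>f. cmod (f z)) ` F_cont_real G T \<Omega> = Kc" "(\<lambda>f. cmod (f z)) ` F_sharp_real G \<Omega> = Kc"
    using K1 K2 K3 by blast+
  ultimately show ?thesis
    unfolding C_cont_def C_sharp_def K_cont_def K_sharp_def by simp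
qed

end
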